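(* Let $P$ be an irreducible stochastic matrix on the finite state space $S$, with stationary distribution $\pi$, and let $f:S\to[a,b]$ be a real-valued function, where $a:=\min_{x\in S} f(x)$ and $b:=\max_{x\in S} f(x)$. Put $S_b:=\{x\in S: f(x)=b\}$, and assume that (i) the submatrix of $P$ with rows and columns in $S_b$ is irreducible, and (ii) for every $x\in S\setminus S_b$ there exists $y\in S_b$ such that $P(x,y)>0$. Then, for any initial distribution $q$ on $S$ and every $n\ge1$, $$\mathbb{P}_q\left(\frac1n\sum_{k=1}^n f(X_k)\ge \mu\right)\le K_u\, e^{-n\frac{(\mu-\pi(f))^2}{2\sigma_u^2}}\le K_u\, e^{-n\frac{2(\mu-\pi(f))^2}{(b-a+2K_uL_u)^2}},\quad\text{for }\mu\ge\pi(f),$$ where $\sigma_u^2=\sigma_u^2(P,f):=\sup_{\theta\ge0}\Lambda''(\theta)<\infty$, and $K_u=K_u(P,f):=\sup_{\theta\ge 0,\;x,y\in S}\frac{v_\theta(x)}{v_\theta(y)}<\infty$ and $L_u=L_u(P,f):=\sup_{\theta\ge 0,\;x,y\in S}\left|\frac{d}{d\theta}\frac{v_\theta(x)}{v_\theta(y)}\right|<\infty$ are constants depending on $P$ and $f$.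
   Context: A square nonnegative matrix $A$ is irreducible if for all indices $x,y$ there is $n\ge1$ with $A^n(x,y)>0$ (in particular the $1\times1$ zero matrix is not irreducible). $\mathbb{P}_q$ is the law of the Markov chain $(X_k)_{k\ge0}$ on $S$ with $X_0\sim q$ and transition probability matrix $P$. $\pi(f):=\sum_x f(x)\pi(x)$. For $\theta\in\mathbb{R}$ let $\tilde P_\theta(x,y):=P(x,y)e^{\theta f(y)}$, which is nonnegative and irreducible; let $\rho(\theta)$ be its spectral radius (Perron-Frobenius eigenvalue), and let $u_\theta,v_\theta$ be the unique entrywise positive left and right eigenvectors of $\tilde P_\theta$ for the eigenvalue $\rho(\theta)$ with $\sum_x u_\theta(x)=1$ and $\sum_x u_\theta(x)v_\theta(x)=1$. $\Lambda(\theta):=\log\rho(\theta)$, and $\Lambda''$ is its second derivative in $\theta$. *)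

theory Defs
  imports "HOL-Probability.Probability"
begin

definition stochastic :: "real ^ 's ^ 's \<Rightarrow> bool" where
  "stochastic P \<longleftrightarrow> (\<forall>x y. 0 \<le> P $ x $ y) \<and> (\<forall>x. (\<Sum>y\<in>UNIV. P $ x $ y) = 1)"

definition prob_vector :: "real ^ 's \<Rightarrow> bool" where
  "prob_vector q \<longleftrightarrow> (\<forall>x. 0 \<le> q $ x) \<and> (\<Sum>x\<in>UNIV. q $ x) = 1"

definition stationary :: "real ^ 's ^ 's \<Rightarrow> real ^ 's \<Rightarrow> bool" where
  "stationary P \<pi> \<longleftrightarrow> prob_vector \<pi> \<and> \<pi> v* P = \<pi>"

definition expect :: "real ^ 's \<Rightarrow> ('s \<Rightarrow> real) \<Rightarrow> real" where
  "expect \<pi> f = (\<Sum>x\<in>UNIV. f x * \<pi> $ x)"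

text \<open>For \<open>x\<close>, \<open>y\<close> in \<open>T\<close>, \<open>submatrix_power T A n x y\<close> is the \<open>(x, y)\<close> entry of the \<open>n\<close>-th power of
  the submatrix of \<open>A\<close> with rows and columns in \<open>T\<close>; with \<open>T = UNIV\<close> it is the power of \<open>A\<close> itself.
  (The operation \<open>A ^ n\<close> on type \<open>vec\<close> is componentwise and not the matrix power.)\<close>

primrec submatrix_power :: "'s::finite set \<Rightarrow> real ^ 's ^ 's \<Rightarrow> nat \<Rightarrow> 's \<Rightarrow> 's \<Rightarrow> real" where
  "submatrix_power T A 0 = (\<lambda>x y. if x = y then 1 else 0)"
| "submatrix_power T A (Suc n) = (\<lambda>x y. \<Sum>z\<in>T. A $ x $ z * submatrix_power T A n z y)"

definition irreducible_on :: "'s::finite set \<Rightarrow> real ^ 's ^ 's \<Rightarrow> bool" where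
  "irreducible_on T A \<longleftrightarrow>
     (\<forall>x\<in>T. \<forall>y\<in>T. 0 \<le> A $ x $ y) \<and>
     (\<forall>x\<in>T. \<forall>y\<in>T. \<exists>n\<ge>1. submatrix_power T A n x y > 0)"

definition markov_chain ::
  "'w measure \<Rightarrow> (nat \<Rightarrow> 'w \<Rightarrow> 's::finite) \<Rightarrow> real ^ 's \<Rightarrow> real ^ 's ^ 's \<Rightarrow> bool" where
  "markov_chain M X q P \<longleftrightarrow>
     prob_space M \<and>
     (\<forall>k. X k \<in> measurable M (count_space UNIV)) \<and>
     (\<forall>x. \<P>(\<omega> in M. X 0 \<omega> = x) = q $ x) \<and>
     (\<forall>n x y. \<P>(\<omega> in M. \<forall>k\<le>n. X k \<omega> = x k) > 0 \<longrightarrow>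
        \<P>(\<omega> in M. X (Suc n) \<omega> = y \<bar> \<forall>k\<le>n. X k \<omega> = x k) = P $ x n $ y)"

definition tilted :: "real ^ 's ^ 's \<Rightarrow> ('s \<Rightarrow> real) \<Rightarrow> real \<Rightarrow> real ^ 's ^ 's" where
  "tilted P f \<theta> = (\<chi> x y. P $ x $ y * exp (\<theta> * f y))"

definition spectral_radius :: "real ^ 's ^ 's \<Rightarrow> real" where
  "spectral_radius A =
     Max {cmod z | z. \<exists>w::complex ^ 's. w \<noteq> 0 \<and> map_matrix complex_of_real A *v w = z *s w}"

definition perron_pair :: "real ^ 's ^ 's \<Rightarrow> (real ^ 's) \<times> (real ^ 's)" where
  "perron_pair A = (THE (u, v).
     (\<forall>x. 0 < u $ x) \<and> (\<forall>x. 0 < v $ x) \<and>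
     u v* A = spectral_radius A *s u \<and>
     A *v v = spectral_radius A *s v \<and>
     (\<Sum>x\<in>UNIV. u $ x) = 1 \<and> (\<Sum>x\<in>UNIV. u $ x * v $ x) = 1)"

definition perron_right :: "real ^ 's ^ 's \<Rightarrow> ('s \<Rightarrow> real) \<Rightarrow> real \<Rightarrow> 's \<Rightarrow> real" where
  "perron_right P f \<theta> x = snd (perron_pair (tilted P f \<theta>)) $ x"

definition Lam :: "real ^ 's ^ 's \<Rightarrow> ('s \<Rightarrow> real) \<Rightarrow> real \<Rightarrow> real" where
  "Lam P f \<theta> = ln (spectral_radius (tilted P f \<theta>))"

text \<open>The suprema are taken in \<open>ereal\<close>, so that their finiteness is a genuine claim.\<close>

definition sigma_u_sq :: "real ^ 's ^ 's \<Rightarrow> ('s \<Rightarrow> real) \<Rightarrow> ereal" where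
  "sigma_u_sq P f = (SUP \<theta>\<in>{0..}. ereal (deriv (deriv (Lam P f)) \<theta>))"

definition K_u :: "real ^ 's ^ 's \<Rightarrow> ('s \<Rightarrow> real) \<Rightarrow> ereal" where
  "K_u P f = (SUP (\<theta>, x, y)\<in>{0..} \<times> UNIV \<times> UNIV.
     ereal (perron_right P f \<theta> x / perron_right P f \<theta> y))"

definition L_u :: "real ^ 's ^ 's \<Rightarrow> ('s \<Rightarrow> real) \<Rightarrow> ereal" where
  "L_u P f = (SUP (\<theta>, x, y)\<in>{0..} \<times> UNIV \<times> UNIV.
     ereal \<bar>deriv (\<lambda>t. perron_right P f t x / perron_right P f t y) \<theta>\<bar>)"

text \<open>With the exponent computed in \<open>ereal\<close>, where \<open>t / 0 = \<infinity>\<close> for \<open>t > 0\<close> and \<open>0 / 0 = 0\<close>, a bound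
  \<open>exp (- t / c)\<close> reads in the degenerate case \<open>c = 0\<close> (constant \<open>f\<close>) as \<open>0\<close> for \<open>t > 0\<close> and as \<open>1\<close>
  for \<open>t = 0\<close>; real division would give \<open>1\<close> for every \<open>t\<close>.\<close>

definition exp_ereal :: "ereal \<Rightarrow> ereal" where
  "exp_ereal t = (if t = \<infinity> then \<infinity> else if t = -\<infinity> then 0 else ereal (exp (real_of_ereal t)))"

end

theory Submission
  imports Defs
begin

text \<open>Let \<open>h\<^sub>\<theta> = ln v\<^sub>\<theta>\<close> and let \<open>p\<^sub>\<theta>(x, y) = P(x, y) exp (\<theta> f(y) + h\<^sub>\<theta>(y) - h\<^sub>\<theta>(x) - \<Lambda>(\<theta>))\<close> be the twisted
  stochastic matrix. Its logarithmic derivative \<open>g = f(y) - \<Lambda>' + h'(y) - h'(x)\<close> has mean zero under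
  every row of \<open>p\<^sub>\<theta>\<close>; differentiating this identity once more and averaging over the stationary
  distribution of \<open>p\<^sub>\<theta>\<close> shows that \<open>\<Lambda>''\<close> is the stationary mean of \<open>g\<^sup>2\<close>. Since \<open>g\<close> takes values in an
  interval of length \<open>b - a + 2 K L\<close>, Popoviciu's inequality bounds \<open>\<Lambda>''\<close> by \<open>(b - a + 2 K L)\<^sup>2 / 4\<close>.
  The tail bound is Chernoff's inequality combined with Taylor's formula
  \<open>\<Lambda>(\<theta>) \<le> \<theta> \<pi>(f) + \<sigma>\<^sup>2 \<theta>\<^sup>2 / 2\<close>.

  The constants are finite because every state reaches every state of \<open>S\<^sub>b\<close> along edges of \<open>P\<close> that
  end in \<open>S\<^sub>b\<close>, and the normalised tilting by \<open>exp (\<theta> (f - b))\<close> leaves the weights of these edges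
  unchanged.\<close>

section \<open>Perron-Frobenius theory for irreducible matrices\<close>

definition strongly_connected :: "real ^ 's ^ 's \<Rightarrow> bool" where
  "strongly_connected A \<longleftrightarrow> (\<forall>i j. 0 \<le> A $ i $ j) \<and>
     (\<forall>Z. Z \<noteq> {} \<longrightarrow> Z \<noteq> UNIV \<longrightarrow> (\<exists>i\<in>Z. \<exists>j\<in>-Z. A $ i $ j > 0))"

lemma strongly_connected_nonneg: "strongly_connected A \<Longrightarrow> 0 \<le> A $ i $ j"
  by (simp add: strongly_connected_def)

lemma irreducible_imp_strongly_connected:
  assumes "irreducible_on UNIV A"
  shows "strongly_connected A"
  unfolding strongly_connected_def
proof (intro conjI allI impI)
  fix i j show nn: "0 \<le> A $ i $ j" using assms by (auto simp: irreducible_on_def)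
next
  fix Z :: "'a set" assume Z: "Z \<noteq> {}" "Z \<noteq> UNIV"
  show "\<exists>i\<in>Z. \<exists>j\<in>-Z. A $ i $ j > 0"
  proof (rule ccontr)
    assume "\<not> ?thesis"
    moreover have "0 \<le> A $ i $ j" for i j using assms by (auto simp: irreducible_on_def)
    ultimately have z: "A $ i $ j = 0" if "i \<in> Z" "j \<notin> Z" for i j
      using that by (metis ComplI less_eq_real_def)
    have "submatrix_power UNIV A n i j = 0" if "i \<in> Z" "j \<notin> Z" for i j n
      using that
    proof (induction n arbitrary: i)
      case (Suc n)
      then show ?case
        by (auto intro!: sum.neutral simp: z) (metis z)
    qed auto
    then show False using Z assms
      unfolding irreducible_on_def by (metis UNIV_I UNIV_eq_I ex_in_conv less_irrefl)
  qed
qed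

lemma strongly_connected_transpose:
  assumes "strongly_connected A"
  shows "strongly_connected (transpose A)"
  unfolding strongly_connected_def
proof (intro conjI allI impI)
  fix i j show "0 \<le> transpose A $ i $ j"
    using assms by (simp add: strongly_connected_def transpose_def)
next
  fix Z :: "'a set" assume "Z \<noteq> {}" "Z \<noteq> UNIV"
  then have "- Z \<noteq> {}" "- Z \<noteq> UNIV" by auto
  then obtain i j where "i \<in> - Z" "j \<in> - (- Z)" "A $ i $ j > 0"
    using assms unfolding strongly_connected_def by metis
  then show "\<exists>i\<in>Z. \<exists>j\<in>-Z. transpose A $ i $ j > 0"
    by (auto simp: transpose_def)
qed

lemma eigenvector_entry:
  fixes A :: "real ^ 's ^ 's::finite"
  assumes "A *v x = r *s x"
  shows "(\<Sum>j\<in>UNIV. A $ i $ j * x $ j) = r * x $ i"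
  using arg_cong[OF assms, of "\<lambda>v. v $ i"] by (simp add: matrix_vector_mult_def)

lemma left_eigenvector_entry:
  fixes A :: "real ^ 's ^ 's::finite"
  assumes "u v* A = r *s u"
  shows "(\<Sum>i\<in>UNIV. u $ i * A $ i $ j) = r * u $ j"
  using arg_cong[OF assms, of "\<lambda>v. v $ j"] by (simp add: vector_matrix_mult_def mult.commute)

text \<open>In a row where \<open>x\<close> vanishes the eigenvalue equation makes a sum of
  nonnegative terms vanish, so no positive entry of \<open>A\<close> leads out of the zero set of
  \<open>x\<close>.\<close>

lemma nonneg_eigenvector_pos:
  fixes A :: "real ^ 's ^ 's::finite"
  assumes A: "strongly_connected A" and x: "A *v x = r *s x" "\<And>i. 0 \<le> x $ i" "x \<noteq> 0"
  shows "0 < x $ i"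
proof (rule ccontr)
  assume "\<not> 0 < x $ i"
  define Z where "Z = {i. x $ i = 0}"
  have "Z \<noteq> {}" using \<open>\<not> 0 < x $ i\<close> x(2)[of i] by (auto simp: Z_def)
  moreover have "Z \<noteq> UNIV" using x(3) by (auto simp: Z_def vec_eq_iff)
  ultimately obtain k j where kj: "k \<in> Z" "j \<in> -Z" "A $ k $ j > 0"
    using A unfolding strongly_connected_def by metis
  have "0 < A $ k $ j * x $ j" using kj x(2)[of j] by (auto simp: Z_def)
  also have "\<dots> \<le> (\<Sum>j\<in>UNIV. A $ k $ j * x $ j)"
    by (rule member_le_sum) (auto intro!: mult_nonneg_nonneg x strongly_connected_nonneg[OF A])
  also have "\<dots> = 0" using eigenvector_entry[OF x(1), of k] kj by (simp add: Z_def)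
  finally show False by simp
qed

text \<open>Brouwer's theorem on the simplex, for the normalisation of \<open>x + A x\<close>.
  Adding \<open>x\<close> keeps the normaliser \<open>N x\<close> at least 1, and a fixed point is
  an eigenvector for \<open>N x - 1\<close>.\<close>

lemma ex_pos_eigenvector:
  fixes A :: "real ^ 's ^ 's::finite"
  assumes A: "strongly_connected A"
  shows "\<exists>r x. A *v x = r *s x \<and> (\<forall>i. 0 < x $ i)"
proof -
  define S :: "(real ^ 's) set" where "S = {x. (\<forall>i. 0 \<le> x $ i) \<and> (\<Sum>i\<in>UNIV. x $ i) = 1}"
  define N where "N x = (\<Sum>i\<in>UNIV. x $ i + (A *v x) $ i)" for x :: "real ^ 's"
  define F where "F x = (1 / N x) *\<^sub>R (x + A *v x)" for x :: "real ^ 's"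
  have Ax: "0 \<le> (A *v x) $ i" if "x \<in> S" for x i
    using that by (auto simp: S_def matrix_vector_mult_def intro!: sum_nonneg mult_nonneg_nonneg
        strongly_connected_nonneg[OF A])
  have N: "N x \<ge> 1" if "x \<in> S" for x
  proof -
    have "0 \<le> (\<Sum>i\<in>UNIV. (A *v x) $ i)" by (intro sum_nonneg Ax that)
    then show ?thesis using that by (simp add: N_def sum.distrib S_def)
  qed
  have "compact S"
  proof -
    have "closed S" unfolding S_def
      by (intro closed_Collect_conj closed_Collect_all closed_Collect_le closed_Collect_eq
          continuous_intros)
    moreover have "bounded S"
    proof (rule boundedI)
      fix x assume "x \<in> S"
      then have "(\<Sum>i\<in>UNIV. \<bar>x $ i\<bar>) = 1" by (simp add: S_def)
      then show "norm x \<le> 1" using norm_le_l1_cart[of x] by simp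
    qed
    ultimately show ?thesis by (simp add: compact_eq_bounded_closed)
  qed
  moreover have "convex S" unfolding S_def
    by (auto simp: convex_def sum.distrib sum_distrib_left[symmetric])
  moreover have "S \<noteq> {}"
  proof -
    have "axis undefined 1 \<in> S" by (auto simp: S_def axis_def)
    then show ?thesis by auto
  qed
  moreover have "continuous_on S F"
    unfolding F_def N_def using N unfolding N_def
    by (intro continuous_intros matrix_vector_mult_linear_continuous_on) (smt (verit))+
  moreover have "F \<in> S \<rightarrow> S"
  proof
    fix x assume x: "x \<in> S"
    have "(\<Sum>i\<in>UNIV. F x $ i) = (\<Sum>i\<in>UNIV. x $ i + (A *v x) $ i) / N x"
      by (simp add: F_def sum_divide_distrib)
    also have "\<dots> = 1" using N[OF x] by (simp add: N_def)
    finally show "F x \<in> S" using N[OF x] Ax[OF x] x by (auto simp: S_def F_def)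
  qed
  ultimately obtain x where x: "x \<in> S" "F x = x" by (rule brouwer)
  have "A *v x = (N x - 1) *s x"
  proof (subst vec_eq_iff, intro allI)
    fix i
    have "x $ i = (x $ i + (A *v x) $ i) / N x"
      using arg_cong[OF x(2), of "\<lambda>v. v $ i"] by (simp add: F_def)
    then show "(A *v x) $ i = ((N x - 1) *s x) $ i" using N[OF x(1)] by (simp add: field_simps)
  qed
  moreover have "x \<noteq> 0" using x(1) by (auto simp: S_def)
  moreover have "0 \<le> x $ i" for i using x(1) by (simp add: S_def)
  ultimately show ?thesis using nonneg_eigenvector_pos[OF A, of x "N x - 1"] by blast
qed

text \<open>Subtract from \<open>z\<close> the largest multiple of \<open>x\<close> that leaves a
  nonnegative vector. The difference solves the same eigenvalue equation and has a zero entry, so by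
  \<open>nonneg_eigenvector_pos\<close> it is zero.\<close>

lemma pos_eigenvector_unique:
  fixes A :: "real ^ 's ^ 's::finite"
  assumes A: "strongly_connected A" and x: "A *v x = r *s x" "\<And>i. 0 < x $ i"
    and z: "A *v z = r *s z"
  shows "\<exists>t. z = t *s x"
proof -
  define t where "t = Min (range (\<lambda>i. z $ i / x $ i))"
  have t: "t \<le> z $ i / x $ i" for i unfolding t_def by (rule Min_le) auto
  have "t \<in> range (\<lambda>i. z $ i / x $ i)" unfolding t_def by (rule Min_in) auto
  then obtain k where k: "t = z $ k / x $ k" by auto
  define y where "y = z - t *s x"
  have "A *v y = r *s y"
    unfolding y_def using x(1) z
    by (simp add: matrix_vector_mult_diff_distrib vector_scalar_commute
        vector_ssub_ldistrib vector_smult_assoc mult.commute)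
  moreover have "0 \<le> y $ i" for i using t[of i] x(2)[of i] by (simp add: y_def field_simps)
  moreover have "y $ k = 0" using k x(2)[of k] by (simp add: y_def)
  ultimately have "y = 0" using nonneg_eigenvector_pos[OF A, of y r k] by force
  then show ?thesis by (auto simp: y_def)
qed

section \<open>Left eigenvectors, the spectral radius and the Perron pair\<close>

lemma left_right_eigenvalue_eq:
  fixes A :: "real ^ 's ^ 's::finite"
  assumes u: "u v* A = s *s u" "\<And>i. 0 < u $ i" and x: "A *v x = r *s x" "\<And>i. 0 < x $ i"
  shows "s = r"
proof -
  have "s * (\<Sum>j\<in>UNIV. u $ j * x $ j) = (\<Sum>j\<in>UNIV. (\<Sum>i\<in>UNIV. u $ i * A $ i $ j) * x $ j)"
    by (simp add: left_eigenvector_entry[OF u(1)] sum_distrib_left mult_ac)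
  also have "\<dots> = (\<Sum>i\<in>UNIV. u $ i * (\<Sum>j\<in>UNIV. A $ i $ j * x $ j))"
    by (simp add: sum_distrib_left sum_distrib_right mult_ac) (rule sum.swap)
  also have "\<dots> = r * (\<Sum>j\<in>UNIV. u $ j * x $ j)"
    unfolding eigenvector_entry[OF x(1)] by (simp add: sum_distrib_left mult_ac)
  finally have "s * (\<Sum>j\<in>UNIV. u $ j * x $ j) = r * (\<Sum>j\<in>UNIV. u $ j * x $ j)" .
  moreover have "(\<Sum>j\<in>UNIV. u $ j * x $ j) > 0" by (intro sum_pos mult_pos_pos u x) auto
  ultimately show ?thesis by simp
qed

lemma ex_pos_left_eigenvector:
  fixes A :: "real ^ 's ^ 's::finite"
  assumes A: "strongly_connected A" and x: "A *v x = r *s x" "\<And>i. 0 < x $ i"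
  shows "\<exists>u. u v* A = r *s u \<and> (\<forall>i. 0 < u $ i)"
proof -
  obtain s u where "transpose A *v u = s *s u" "\<forall>i. 0 < u $ i"
    using ex_pos_eigenvector[OF strongly_connected_transpose[OF A]] by auto
  then have u: "u v* A = s *s u" "\<forall>i. 0 < u $ i" by simp_all
  then show ?thesis using left_right_eigenvalue_eq[OF u(1) _ x] by auto
qed

text \<open>Taking moduli in the eigenvalue equation gives an entrywise inequality for
  \<open>cmod (w $ i)\<close>; pairing it with the positive left eigenvector turns \<open>A\<close>
  into the factor \<open>r\<close>.\<close>

lemma cmod_eigenvalue_le:
  fixes A :: "real ^ 's ^ 's::finite"
  assumes A: "\<And>i j. 0 \<le> A $ i $ j" and u: "u v* A = r *s u" "\<And>i. 0 < u $ i"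
    and w: "w \<noteq> 0" "map_matrix complex_of_real A *v w = z *s w"
  shows "cmod z \<le> r"
proof -
  have "cmod z * cmod (w $ i) \<le> (\<Sum>j\<in>UNIV. A $ i $ j * cmod (w $ j))" for i
  proof -
    have "z * w $ i = (\<Sum>j\<in>UNIV. complex_of_real (A $ i $ j) * w $ j)"
      using arg_cong[OF w(2), of "\<lambda>v. v $ i"] by (simp add: matrix_vector_mult_def map_matrix_def)
    then have "cmod z * cmod (w $ i) = cmod (\<Sum>j\<in>UNIV. complex_of_real (A $ i $ j) * w $ j)"
      by (metis norm_mult)
    also have "\<dots> \<le> (\<Sum>j\<in>UNIV. cmod (complex_of_real (A $ i $ j) * w $ j))" by (rule norm_sum)
    also have "\<dots> = (\<Sum>j\<in>UNIV. A $ i $ j * cmod (w $ j))" by (simp add: norm_mult A)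
    finally show ?thesis .
  qed
  then have "(\<Sum>i\<in>UNIV. u $ i * (cmod z * cmod (w $ i)))
      \<le> (\<Sum>i\<in>UNIV. u $ i * (\<Sum>j\<in>UNIV. A $ i $ j * cmod (w $ j)))"
    by (intro sum_mono mult_left_mono less_imp_le[OF u(2)])
  also have "\<dots> = (\<Sum>j\<in>UNIV. (\<Sum>i\<in>UNIV. u $ i * A $ i $ j) * cmod (w $ j))"
    by (simp add: sum_distrib_left sum_distrib_right mult_ac) (rule sum.swap)
  also have "\<dots> = r * (\<Sum>i\<in>UNIV. u $ i * cmod (w $ i))"
    by (simp add: left_eigenvector_entry[OF u(1)] sum_distrib_left mult_ac)
  finally have "cmod z * (\<Sum>i\<in>UNIV. u $ i * cmod (w $ i)) \<le> r * (\<Sum>i\<in>UNIV. u $ i * cmod (w $ i))"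
    by (simp add: sum_distrib_left mult_ac)
  moreover have "(\<Sum>i\<in>UNIV. u $ i * cmod (w $ i)) > 0"
  proof -
    obtain k where "w $ k \<noteq> 0" using w(1) by (auto simp: vec_eq_iff)
    then show ?thesis by (intro sum_pos2[of _ k]) (auto intro!: mult_nonneg_nonneg mult_pos_pos u less_imp_le[OF u(2)])
  qed
  ultimately show ?thesis by simp
qed

text \<open>Makes the \<open>Max\<close> in \<open>spectral_radius\<close> meaningful. The
  eigenvalues are the roots of the polynomial \<open>det Q\<close>, which is nonzero because
  \<open>\<bar>r\<bar> + 1\<close> lies beyond the assumed bound and so is not a root.\<close>

lemma finite_eigenvalues:
  fixes B :: "complex ^ 's ^ 's::finite"
  assumes bd: "\<And>w z. w \<noteq> 0 \<Longrightarrow> B *v w = z *s w \<Longrightarrow> cmod z \<le> r"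
  shows "finite {z. \<exists>w. w \<noteq> 0 \<and> B *v w = z *s w}"
proof -
  define Q :: "complex poly ^ 's ^ 's" where
    "Q = (\<chi> i j. [:- (B $ i $ j), if i = j then 1 else 0:])"
  define M where "M z = mat z - B" for z
  have M: "M z *v w = z *s w - B *v w" for z w
    by (simp add: M_def matrix_vector_mult_diff_rdistrib vec_eq_iff mat_def matrix_vector_mult_def
        left_diff_distrib sum_subtractf if_distrib[where f="\<lambda>x. x * _"] cong: if_cong)
  have pd: "poly (det Q) z = det (M z)" for z
  proof -
    have e: "poly (Q $ i $ j) z = M z $ i $ j" for i j by (simp add: Q_def M_def mat_def)
    show ?thesis by (simp add: det_def poly_sum poly_prod e of_int_poly)
  qed
  have inv: "det (M z) = 0 \<longleftrightarrow> (\<exists>w. w \<noteq> 0 \<and> B *v w = z *s w)" for z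
  proof -
    have "det (M z) \<noteq> 0 \<longleftrightarrow> (\<forall>w. M z *v w = 0 \<longrightarrow> w = 0)"
      using invertible_det_nz[of "M z"] matrix_left_invertible_ker[of "M z"]
      by (metis invertible_left_inverse)
    then show ?thesis by (auto simp: M)
  qed
  have "det (M (of_real (\<bar>r\<bar> + 1))) \<noteq> 0"
  proof
    assume "det (M (of_real (\<bar>r\<bar> + 1))) = 0"
    then have "cmod (of_real (\<bar>r\<bar> + 1)) \<le> r" using bd unfolding inv by blast
    then show False by (simp only: norm_of_real)
  qed
  then have "det Q \<noteq> 0" using pd by (metis poly_0)
  then have "finite {z. poly (det Q) z = 0}" by (rule poly_roots_finite)
  then show ?thesis by (simp add: pd inv)
qed

text \<open>The eigenvalue of a positive eigenvector is itself a complex eigenvalue, and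
  \<open>cmod_eigenvalue_le\<close> with a positive left eigenvector shows that none has larger
  modulus.\<close>

lemma spectral_radius_eq:
  fixes A :: "real ^ 's ^ 's::finite"
  assumes A: "strongly_connected A" and x: "A *v x = r *s x" "\<And>i. 0 < x $ i"
  shows "spectral_radius A = r"
proof -
  obtain u where u: "u v* A = r *s u" "\<And>i. 0 < u $ i" using ex_pos_left_eigenvector[OF A x] by auto
  note le = cmod_eigenvalue_le[OF strongly_connected_nonneg[OF A] u]
  define E where "E = {z. \<exists>w::complex ^ 's. w \<noteq> 0 \<and> map_matrix complex_of_real A *v w = z *s w}"
  have "r \<ge> 0"
  proof -
    have "0 \<le> (\<Sum>j\<in>UNIV. A $ undefined $ j * x $ j)"
      by (intro sum_nonneg mult_nonneg_nonneg strongly_connected_nonneg[OF A] less_imp_le[OF x(2)])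
    also have "\<dots> = r * x $ undefined" by (rule eigenvector_entry[OF x(1)])
    finally show ?thesis using x(2)[of undefined] by (simp add: zero_le_mult_iff)
  qed
  have "finite E" unfolding E_def by (rule finite_eigenvalues) (rule le)
  moreover have "complex_of_real r \<in> E"
  proof -
    have "map_matrix complex_of_real A *v (\<chi> i. complex_of_real (x $ i))
        = complex_of_real r *s (\<chi> i. complex_of_real (x $ i))"
      by (simp add: vec_eq_iff matrix_vector_mult_def map_matrix_def eigenvector_entry[OF x(1)]
          flip: of_real_mult of_real_sum)
    moreover have "(\<chi> i. complex_of_real (x $ i)) \<noteq> 0" using x(2)[of undefined]
      by (auto simp: vec_eq_iff intro!: exI[of _ undefined])
    ultimately show ?thesis unfolding E_def by blast
  qed
  ultimately have "Max (cmod ` E) = r" using \<open>r \<ge> 0\<close> le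
    by (intro Max_eqI) (auto simp: E_def image_iff intro!: exI[of _ "complex_of_real r"])
  then show ?thesis unfolding spectral_radius_def E_def by (simp add: setcompr_eq_image)
qed

text \<open>Discharges the definite description in \<open>perron_pair\<close>: each eigenvector is
  unique up to a factor, and the two normalisations fix both factors.\<close>

lemma perron_pair:
  fixes A :: "real ^ 's ^ 's::finite"
  assumes A: "strongly_connected A"
  defines "u \<equiv> fst (perron_pair A)" and "v \<equiv> snd (perron_pair A)"
  shows "0 < u $ x" and "0 < v $ x" and "u v* A = spectral_radius A *s u"
    and "A *v v = spectral_radius A *s v"
    and "(\<Sum>x\<in>UNIV. u $ x) = 1" and "(\<Sum>x\<in>UNIV. u $ x * v $ x) = 1"
proof -
  define Q where "Q = (\<lambda>(u, v).
     (\<forall>x. 0 < u $ x) \<and> (\<forall>x. 0 < v $ x) \<and>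
     u v* A = spectral_radius A *s u \<and>
     A *v v = spectral_radius A *s v \<and>
     (\<Sum>x\<in>UNIV. u $ x) = 1 \<and> (\<Sum>x\<in>UNIV. u $ x * v $ x) = 1)"
  obtain r y where y: "A *v y = r *s y" "\<And>i. 0 < y $ i" using ex_pos_eigenvector[OF A] by auto
  obtain z where z: "z v* A = r *s z" "\<And>i. 0 < z $ i" using ex_pos_left_eigenvector[OF A y] by auto
  note r = spectral_radius_eq[OF A y]
  \<comment> \<open>Dividing the left vector by \<open>c\<close> gives it total mass 1; the factor
    \<open>c / d\<close> on the right vector then makes the pairing equal to 1.\<close>
  define c where "c = (\<Sum>x\<in>UNIV. z $ x)"
  define d where "d = (\<Sum>x\<in>UNIV. z $ x * y $ x)"
  have cd: "c > 0" "d > 0" unfolding c_def d_def by (auto intro!: sum_pos mult_pos_pos y z)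
  have zt: "transpose A *v z = r *s z" using z(1) by simp
  have "transpose A *v ((1 / c) *s z) = r *s ((1 / c) *s z)" "A *v ((c / d) *s y) = r *s ((c / d) *s y)"
    by (simp_all add: vector_scalar_commute y(1) zt vector_smult_assoc mult.commute
        del: transpose_matrix_vector)
  moreover have "(\<Sum>x\<in>UNIV. ((1 / c) *s z) $ x) = 1"
    using cd by (simp add: sum_divide_distrib[symmetric] c_def)
  moreover have "(\<Sum>x\<in>UNIV. ((1 / c) *s z) $ x * ((c / d) *s y) $ x) = (1 / d) * d"
    unfolding d_def sum_distrib_left using cd by (intro sum.cong) auto
  ultimately have ex: "Q ((1 / c) *s z, (c / d) *s y)"
    using cd y(2) z(2) by (simp add: Q_def r)
  have uniq: "p = q" if p: "Q p" and q: "Q q" for p q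
  proof -
    obtain u v u' v' where pq: "p = (u, v)" "q = (u', v')" by (metis surj_pair)
    obtain s where s: "u' = s *s u"
      using pos_eigenvector_unique[OF strongly_connected_transpose[OF A], of u "spectral_radius A" u'] p q
      by (auto simp: Q_def pq)
    obtain t where t: "v' = t *s v"
      using pos_eigenvector_unique[OF A, of v "spectral_radius A" v'] p q
      by (auto simp: Q_def pq)
    have "s = 1" using p q unfolding Q_def pq s by (simp add: sum_distrib_left[symmetric])
    moreover have "t = 1" using p q unfolding Q_def pq s \<open>s = 1\<close> t
      by (simp add: sum_distrib_left[symmetric] mult.left_commute)
    ultimately show ?thesis by (simp add: pq s t)
  qed
  have "Q (THE p. Q p)" by (rule theI[of Q, OF ex uniq[OF _ ex]])
  then have "Q (perron_pair A)" by (simp add: perron_pair_def Q_def)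
  then show "0 < u $ x" and "0 < v $ x" and "u v* A = spectral_radius A *s u"
    and "A *v v = spectral_radius A *s v"
    and "(\<Sum>x\<in>UNIV. u $ x) = 1" and "(\<Sum>x\<in>UNIV. u $ x * v $ x) = 1"
    by (auto simp: Q_def u_def v_def split: prod.splits)
qed


section \<open>Smoothness of the Perron eigenvalue and eigenvector\<close>

text \<open>Writing an eigenvector near a reference one as that vector plus a perturbation vanishing at
  \<open>x0\<close>, the eigenvalue equation becomes a linear system for the perturbation, with the change of the
  eigenvalue stored (up to sign) in the free slot \<open>x0\<close>. The matrix of that system is the following
  one, and it is invertible.\<close>

definition bordered :: "real ^ 's ^ 's \<Rightarrow> real \<Rightarrow> 's \<Rightarrow> real ^ 's \<Rightarrow> real ^ 's ^ 's" where
  "bordered A r x0 c = (\<chi> i j. if j = x0 then c $ i else A $ i $ j - (if i = j then r else 0))"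

lemma bordered_mult:
  fixes A :: "real ^ 's ^ 's::finite"
  assumes "\<And>j. j \<noteq> x0 \<Longrightarrow> y $ j = z $ j" "y $ x0 = 0"
  shows "(bordered A r x0 c *v z) $ i = c $ i * z $ x0 + (\<Sum>j\<in>UNIV. A $ i $ j * y $ j) - r * y $ i"
proof -
  have "(if j = x0 then c $ i else A $ i $ j - (if i = j then r else 0)) * z $ j
      = (if j = x0 then c $ i * z $ j else 0) + A $ i $ j * y $ j - (if i = j then r * y $ j else 0)" for j
    using assms by (auto simp: left_diff_distrib)
  then show ?thesis
    by (simp add: bordered_def matrix_vector_mult_def sum.distrib sum_subtractf)
qed

text \<open>Pairing a kernel equation with the left eigenvector removes the perturbation and leaves
  a positive multiple of the slot \<open>x0\<close>, which is therefore zero. What remains is an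
  eigenvector vanishing at \<open>x0\<close>, hence zero.\<close>

lemma det_bordered_nz:
  fixes A :: "real ^ 's ^ 's::finite"
  assumes A: "strongly_connected A" and c: "\<And>i. 0 < c $ i"
  shows "det (bordered A (spectral_radius A) x0 c) \<noteq> 0"
proof -
  define r u v where "r = spectral_radius A" and "u = fst (perron_pair A)" and "v = snd (perron_pair A)"
  note uv = perron_pair[OF A, folded r_def u_def v_def]
  have "z = 0" if "bordered A r x0 c *v z = 0" for z
  proof -
    define y where "y = (\<chi> j. if j = x0 then 0 else z $ j)"
    have e: "c $ i * z $ x0 + (\<Sum>j\<in>UNIV. A $ i $ j * y $ j) - r * y $ i = 0" for i
      using bordered_mult[of x0 y z A r c i] that by (simp add: y_def)
    have "(\<Sum>i\<in>UNIV. u $ i * (\<Sum>j\<in>UNIV. A $ i $ j * y $ j)) = (\<Sum>j\<in>UNIV. (\<Sum>i\<in>UNIV. u $ i * A $ i $ j) * y $ j)"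
      by (simp add: sum_distrib_left sum_distrib_right mult_ac) (rule sum.swap)
    also have "\<dots> = (\<Sum>i\<in>UNIV. u $ i * (r * y $ i))"
      unfolding left_eigenvector_entry[OF uv(3)] by (simp add: mult_ac)
    finally have "(\<Sum>i\<in>UNIV. u $ i * (c $ i * z $ x0 + (\<Sum>j\<in>UNIV. A $ i $ j * y $ j) - r * y $ i))
        = z $ x0 * (\<Sum>i\<in>UNIV. u $ i * c $ i)"
      by (simp add: algebra_simps sum.distrib sum_subtractf sum_distrib_left)
    moreover have "(\<Sum>i\<in>UNIV. u $ i * c $ i) > 0" by (intro sum_pos mult_pos_pos c uv) auto
    ultimately have z0: "z $ x0 = 0" by (simp add: e)
    then have "A *v y = r *s y" using e by (simp add: vec_eq_iff matrix_vector_mult_def)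
    then obtain t where "y = t *s v" using pos_eigenvector_unique[OF A uv(4,2)] by auto
    moreover have "y $ x0 = 0" by (simp add: y_def)
    ultimately have "y = 0" using uv(2)[of x0] by simp
    moreover have "z = y" using z0 by (auto simp: y_def vec_eq_iff)
    ultimately show ?thesis by simp
  qed
  then show ?thesis
    unfolding r_def using invertible_det_nz matrix_left_invertible_ker invertible_left_inverse by metis
qed

lemma tendsto_det:
  fixes C :: "'b \<Rightarrow> real ^ 's ^ 's::finite"
  assumes "\<And>i j. ((\<lambda>h. C h $ i $ j) \<longlongrightarrow> N $ i $ j) F"
  shows "((\<lambda>h. det (C h)) \<longlongrightarrow> det N) F"
  unfolding det_def by (intro tendsto_intros assms)

text \<open>By Cramer's rule each entry of the solution is a quotient of determinants, which are
  continuous in the coefficients; no prior regularity of \<open>z\<close> enters.\<close>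

lemma linear_solution_tendsto:
  fixes C :: "'b \<Rightarrow> real ^ 's ^ 's::finite"
  assumes C: "\<And>i j. ((\<lambda>h. C h $ i $ j) \<longlongrightarrow> N $ i $ j) F"
    and y: "\<And>i. ((\<lambda>h. y h $ i) \<longlongrightarrow> y0 $ i) F"
    and N: "det N \<noteq> 0" "N *v z0 = y0" and ev: "\<forall>\<^sub>F h in F. C h *v z h = y h"
  shows "((\<lambda>h. z h $ k) \<longlongrightarrow> z0 $ k) F"
proof -
  have dC: "((\<lambda>h. det (C h)) \<longlongrightarrow> det N) F" by (rule tendsto_det) (rule C)
  have "((\<lambda>h. det (\<chi> i j. if j = k then y h $ i else C h $ i $ j) / det (C h))
      \<longlongrightarrow> det (\<chi> i j. if j = k then y0 $ i else N $ i $ j) / det N) F"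
    by (intro tendsto_divide tendsto_det dC N) (simp add: C y)
  moreover have "z0 $ k = det (\<chi> i j. if j = k then y0 $ i else N $ i $ j) / det N"
    using cramer[OF N(1), of z0 y0] N(2) by simp
  moreover have "\<forall>\<^sub>F h in F. det (\<chi> i j. if j = k then y h $ i else C h $ i $ j) / det (C h) = z h $ k"
    using ev tendsto_imp_eventually_ne[OF dC N(1)]
  proof eventually_elim
    case (elim h)
    show ?case using cramer[OF elim(2), of "z h" "y h"] elim(1) by simp
  qed
  ultimately show ?thesis by (auto intro: Lim_transform_eventually)
qed

lemma ex_linear_solution:
  fixes N :: "real ^ 's ^ 's::finite"
  assumes "det N \<noteq> 0"
  shows "\<exists>z. N *v z = y"
  using cramer[OF assms, of _ y] by blast

text \<open>The difference quotient \<open>q\<close> of the solution again solves a linear system,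
  with matrix \<open>C (t + h)\<close> and a convergent right-hand side. Its limit \<open>z0\<close>
  is what the product rule predicts from \<open>C z = y\<close>.\<close>

lemma linear_solution_DERIV:
  fixes C :: "real \<Rightarrow> real ^ 's ^ 's::finite"
  assumes C: "\<And>i j. ((\<lambda>s. C s $ i $ j) has_real_derivative C' $ i $ j) (at t)"
    and y: "\<And>i. ((\<lambda>s. y s $ i) has_real_derivative y' $ i) (at t)"
    and N: "det (C t) \<noteq> 0" and eq: "\<And>s. C s *v z s = y s"
  shows "\<exists>D. ((\<lambda>s. z s $ k) has_real_derivative D) (at t)"
proof -
  obtain z0 where z0: "C t *v z0 = y' - C' *v z t" using ex_linear_solution[OF N] by blast
  define q where "q h = (1 / h) *s (z (t + h) - z t)" for h
  define e where "e h = (\<chi> i. (y (t + h) $ i - y t $ i) / h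
      - (\<Sum>j\<in>UNIV. (C (t + h) $ i $ j - C t $ i $ j) / h * z t $ j))" for h
  have "((\<lambda>h. q h $ k) \<longlongrightarrow> z0 $ k) (at 0)"
  proof (rule linear_solution_tendsto[where C = "\<lambda>h. C (t + h)" and N = "C t" and y = e])
    show "((\<lambda>h. C (t + h) $ i $ j) \<longlongrightarrow> C t $ i $ j) (at 0)" for i j
      using DERIV_isCont[OF C[of i j]] by (simp add: isCont_iff)
    have "((\<lambda>h. (y (t + h) $ i - y t $ i) / h - (\<Sum>j\<in>UNIV. (C (t + h) $ i $ j - C t $ i $ j) / h * z t $ j))
        \<longlongrightarrow> y' $ i - (\<Sum>j\<in>UNIV. C' $ i $ j * z t $ j)) (at 0)" for i
      by (intro tendsto_diff tendsto_sum tendsto_mult tendsto_const y[unfolded DERIV_def] C[unfolded DERIV_def])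
    then show "((\<lambda>h. e h $ i) \<longlongrightarrow> (y' - C' *v z t) $ i) (at 0)" for i
      by (simp add: e_def matrix_vector_mult_def)
    show "\<forall>\<^sub>F h in at 0. C (t + h) *v q h = e h"
    proof (rule eventuallyI)
      fix h
      have "e h = (1 / h) *s (y (t + h) - y t) - ((1 / h) *\<^sub>R (C (t + h) - C t)) *v z t"
        by (simp add: vec_eq_iff e_def matrix_vector_mult_def diff_divide_distrib)
      moreover have "((1 / h) *\<^sub>R (C (t + h) - C t)) *v z t = (1 / h) *s ((C (t + h) - C t) *v z t)"
        by (simp only: scaleR_matrix_vector_assoc[symmetric] scalar_mult_eq_scaleR)
      moreover have "C (t + h) *v q h = (1 / h) *s (C (t + h) *v z (t + h) - C (t + h) *v z t)"
        by (simp only: q_def vector_scalar_commute matrix_vector_mult_diff_distrib)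
      ultimately show "C (t + h) *v q h = e h"
        by (simp add: eq matrix_vector_mult_diff_rdistrib vector_ssub_ldistrib)
    qed
  qed (use N z0 in auto)
  then have "((\<lambda>s. z s $ k) has_real_derivative z0 $ k) (at t)"
    by (simp add: DERIV_def q_def diff_divide_distrib)
  then show ?thesis by blast
qed

section \<open>Twice differentiable families of matrices\<close>

locale perron_family =
  fixes A A' A'' :: "real \<Rightarrow> real ^ 's ^ 's::finite" and x0 :: 's
  assumes sc: "\<And>t. strongly_connected (A t)"
    and A: "\<And>t i j. ((\<lambda>s. A s $ i $ j) has_real_derivative A' t $ i $ j) (at t)"
    and A': "\<And>t i j. ((\<lambda>s. A' s $ i $ j) has_real_derivative A'' t $ i $ j) (at t)"
begin

definition rho :: "real \<Rightarrow> real" where "rho t = spectral_radius (A t)"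
definition u :: "real \<Rightarrow> real ^ 's" where "u t = fst (perron_pair (A t))"
definition v :: "real \<Rightarrow> real ^ 's" where "v t = snd (perron_pair (A t))"
text \<open>Scaling to the value 1 at \<open>x0\<close> keeps all ratios of entries and makes every
  increment of \<open>w\<close> vanish at \<open>x0\<close>, as the bordered system
  requires.\<close>

definition w :: "real \<Rightarrow> real ^ 's" where "w t = (1 / v t $ x0) *s v t"

lemmas uv = perron_pair[OF sc, folded rho_def u_def v_def]

lemma w_pos: "0 < w t $ x"
  using uv(2)[of t] by (simp add: w_def)

lemma w_x0: "w t $ x0 = 1"
  using uv(2)[of t x0] by (simp add: w_def)

lemma w_eigen: "(\<Sum>j\<in>UNIV. A t $ i $ j * w t $ j) = rho t * w t $ i"
  by (rule eigenvector_entry) (simp add: w_def vector_scalar_commute uv(4) vector_smult_assoc mult.commute)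

lemma A_tendsto: "((\<lambda>s. A s $ i $ j) \<longlongrightarrow> A t $ i $ j) (at t)"
  using DERIV_isCont[OF A] by (simp add: isCont_def)

text \<open>Pair the eigenvalue equation at \<open>s\<close> with the left eigenvector at
  \<open>t\<close>: \<open>rho s - rho t\<close> becomes a weighted mean of the change of the
  matrix. The bound \<open>B s\<close> does not mention \<open>w s\<close>, whose continuity is not
  yet known.\<close>

lemma rho_isCont: "isCont rho t"
proof -
  define B where "B s = (\<Sum>j\<in>UNIV. (\<Sum>i\<in>UNIV. u t $ i * \<bar>A s $ i $ j - A t $ i $ j\<bar>) / u t $ j)" for s
  have le: "\<bar>rho s - rho t\<bar> \<le> B s" for s
  proof -
    have Bj': "(\<Sum>i\<in>UNIV. u t $ i * \<bar>A s $ i $ j - A t $ i $ j\<bar>) / u t $ j \<le> B s" for j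
      unfolding B_def by (intro member_le_sum) (auto intro!: divide_nonneg_pos sum_nonneg mult_nonneg_nonneg less_imp_le[OF uv(1)] uv(1))
    have Bj: "(\<Sum>i\<in>UNIV. u t $ i * \<bar>A s $ i $ j - A t $ i $ j\<bar>) \<le> B s * u t $ j" for j
      using Bj'[of j] uv(1)[of t j] by (simp add: pos_divide_le_eq)
    have "(\<Sum>i\<in>UNIV. u t $ i * (\<Sum>j\<in>UNIV. A t $ i $ j * w s $ j))
        = (\<Sum>j\<in>UNIV. (\<Sum>i\<in>UNIV. u t $ i * A t $ i $ j) * w s $ j)"
      by (simp add: sum_distrib_left sum_distrib_right mult_ac) (rule sum.swap)
    also have "\<dots> = rho t * (\<Sum>j\<in>UNIV. u t $ j * w s $ j)"
      unfolding left_eigenvector_entry[OF uv(3)] by (simp add: sum_distrib_left mult_ac)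
    finally have 1: "(\<Sum>i\<in>UNIV. u t $ i * (\<Sum>j\<in>UNIV. A t $ i $ j * w s $ j)) = rho t * (\<Sum>j\<in>UNIV. u t $ j * w s $ j)" .
    have 2: "(\<Sum>i\<in>UNIV. u t $ i * (\<Sum>j\<in>UNIV. A s $ i $ j * w s $ j)) = rho s * (\<Sum>j\<in>UNIV. u t $ j * w s $ j)"
      unfolding w_eigen by (simp add: sum_distrib_left mult_ac)
    have pos: "(\<Sum>j\<in>UNIV. u t $ j * w s $ j) > 0" by (intro sum_pos mult_pos_pos uv w_pos) auto
    have diff: "(rho s - rho t) * (\<Sum>j\<in>UNIV. u t $ j * w s $ j)
        = (\<Sum>i\<in>UNIV. \<Sum>j\<in>UNIV. u t $ i * (A s $ i $ j - A t $ i $ j) * w s $ j)"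
      unfolding left_diff_distrib 1[symmetric] 2[symmetric]
      by (simp add: sum_distrib_left right_diff_distrib left_diff_distrib sum_subtractf mult.assoc)
    have "\<bar>rho s - rho t\<bar> * (\<Sum>j\<in>UNIV. u t $ j * w s $ j)
        = \<bar>\<Sum>i\<in>UNIV. \<Sum>j\<in>UNIV. u t $ i * (A s $ i $ j - A t $ i $ j) * w s $ j\<bar>"
      unfolding diff[symmetric] abs_mult abs_of_pos[OF pos] ..
    also have "\<dots> \<le> (\<Sum>i\<in>UNIV. \<Sum>j\<in>UNIV. \<bar>u t $ i * (A s $ i $ j - A t $ i $ j) * w s $ j\<bar>)"
      by (rule order_trans[OF sum_abs]) (intro sum_mono sum_abs)
    also have "\<dots> = (\<Sum>i\<in>UNIV. \<Sum>j\<in>UNIV. u t $ i * \<bar>A s $ i $ j - A t $ i $ j\<bar> * w s $ j)"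
      using w_pos[of s] uv(1)[of t] by (simp add: abs_mult less_imp_le)
    also have "\<dots> = (\<Sum>j\<in>UNIV. (\<Sum>i\<in>UNIV. u t $ i * \<bar>A s $ i $ j - A t $ i $ j\<bar>) * w s $ j)"
      by (simp add: sum_distrib_right) (rule sum.swap)
    also have "\<dots> \<le> (\<Sum>j\<in>UNIV. (B s * u t $ j) * w s $ j)"
      by (intro sum_mono mult_right_mono Bj less_imp_le[OF w_pos])
    also have "\<dots> = B s * (\<Sum>j\<in>UNIV. u t $ j * w s $ j)" by (simp add: sum_distrib_left mult_ac)
    finally show ?thesis using pos by simp
  qed
  have "(B \<longlongrightarrow> (\<Sum>j\<in>UNIV. (\<Sum>i\<in>UNIV. u t $ i * \<bar>A t $ i $ j - A t $ i $ j\<bar>) / u t $ j)) (at t)"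
    unfolding B_def using uv(1)[of t]
    by (intro tendsto_sum tendsto_divide tendsto_mult tendsto_rabs tendsto_diff tendsto_const A_tendsto)
      (simp add: less_imp_neq[symmetric])
  then have "(B \<longlongrightarrow> 0) (at t)" by simp
  then have "((\<lambda>s. rho s - rho t) \<longlongrightarrow> 0) (at t)"
    by (rule Lim_null_comparison[rotated]) (simp add: le)
  then show ?thesis unfolding isCont_def by (simp add: LIM_zero_iff)
qed

text \<open>With the entry at \<open>x0\<close> moved to the right-hand side, the eigenvalue
  equation is a bordered system whose slot \<open>x0\<close> is zero. The border 1 serves to make
  its matrix invertible.\<close>

lemma w_isCont: "isCont (\<lambda>s. w s $ k) t"
proof -
  define z where "z s = (\<chi> j. if j = x0 then 0 else w s $ j)" for s
  define y where "y s = (\<chi> i. (if i = x0 then rho s else 0) - A s $ i $ x0)" for s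
  have eq: "bordered (A s) (rho s) x0 1 *v z s = y s" for s
  proof (subst vec_eq_iff, intro allI)
    fix i
    have "A s $ i $ j * z s $ j = A s $ i $ j * w s $ j - (if j = x0 then A s $ i $ j else 0)" for j
      by (simp add: z_def w_x0)
    then have "(\<Sum>j\<in>UNIV. A s $ i $ j * z s $ j) = rho s * w s $ i - A s $ i $ x0"
      by (simp add: sum_subtractf w_eigen)
    then show "(bordered (A s) (rho s) x0 1 *v z s) $ i = y s $ i"
      by (subst bordered_mult[of x0 "z s"]) (auto simp: z_def y_def w_x0)
  qed
  have rc: "(rho \<longlongrightarrow> rho t) (at t)" using rho_isCont by (simp add: isCont_def)
  have "((\<lambda>s. z s $ k) \<longlongrightarrow> z t $ k) (at t)"
  proof (rule linear_solution_tendsto[where C = "\<lambda>s. bordered (A s) (rho s) x0 1" and y = y, OF _ _ _ eq])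
    show "((\<lambda>s. bordered (A s) (rho s) x0 1 $ i $ j) \<longlongrightarrow> bordered (A t) (rho t) x0 1 $ i $ j) (at t)" for i j
      unfolding bordered_def using tendsto_diff[OF A_tendsto[of i j] rc] A_tendsto by auto
    show "((\<lambda>s. y s $ i) \<longlongrightarrow> y t $ i) (at t)" for i
      unfolding y_def using tendsto_diff[OF rc A_tendsto[of i x0]] tendsto_minus[OF A_tendsto] by auto
    show "det (bordered (A t) (rho t) x0 1) \<noteq> 0"
      by (simp add: rho_def det_bordered_nz[OF sc])
    show "\<forall>\<^sub>F s in at t. bordered (A s) (rho s) x0 1 *v z s = y s" by (simp add: eq)
  qed
  then show ?thesis
    by (cases "k = x0") (simp_all add: isCont_def w_x0 z_def)
qed

text \<open>The system obtained by differentiating \<open>A w = rho w\<close>: slot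
  \<open>x0\<close> holds minus the derivative of \<open>rho\<close>, the other slots hold the
  derivatives of the entries of \<open>w\<close>.\<close>

definition dz :: "real \<Rightarrow> real ^ 's" where
  "dz t = (SOME z. bordered (A t) (rho t) x0 (w t) *v z = (\<chi> i. - (\<Sum>j\<in>UNIV. A' t $ i $ j * w t $ j)))"

lemma dz: "bordered (A t) (rho t) x0 (w t) *v dz t = (\<chi> i. - (\<Sum>j\<in>UNIV. A' t $ i $ j * w t $ j))"
  unfolding dz_def
  by (rule someI_ex, rule ex_linear_solution) (simp add: rho_def det_bordered_nz[OF sc] w_pos)

text \<open>The difference quotients \<open>z h\<close> solve a bordered system exactly, and
  continuity of \<open>w\<close> suffices to pass to the limit.\<close>

lemma rho_w_DERIV:
  shows "(rho has_real_derivative - dz t $ x0) (at t)"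
    and "((\<lambda>s. w s $ k) has_real_derivative (if k = x0 then 0 else dz t $ k)) (at t)"
proof -
  define z where "z h = (\<chi> k. if k = x0 then - (rho (t + h) - rho t) / h else (w (t + h) $ k - w t $ k) / h)" for h
  define y where "y h = (\<chi> i. - (\<Sum>j\<in>UNIV. (A (t + h) $ i $ j - A t $ i $ j) / h * w (t + h) $ j))" for h
  \<comment> \<open>The border is \<open>w (t + h)\<close> because the increment of
    \<open>rho w\<close> is split as the increment of \<open>rho\<close> times
    \<open>w (t + h)\<close> plus \<open>rho t\<close> times the increment of
    \<open>w\<close>.\<close>
  have eq: "bordered (A t) (rho t) x0 (w (t + h)) *v z h = y h" if "h \<noteq> 0" for h
  proof (subst vec_eq_iff, intro allI)
    fix i
    have "(bordered (A t) (rho t) x0 (w (t + h)) *v z h) $ i = w (t + h) $ i * (- (rho (t + h) - rho t) / h)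
        + (\<Sum>j\<in>UNIV. A t $ i $ j * ((w (t + h) $ j - w t $ j) / h)) - rho t * ((w (t + h) $ i - w t $ i) / h)"
      by (subst bordered_mult[where y = "\<chi> j. (w (t + h) $ j - w t $ j) / h"]) (auto simp: z_def w_x0)
    also have "(\<Sum>j\<in>UNIV. A t $ i $ j * ((w (t + h) $ j - w t $ j) / h))
        = ((\<Sum>j\<in>UNIV. A t $ i $ j * w (t + h) $ j) - rho t * w t $ i) / h"
      by (simp add: w_eigen[symmetric] sum_subtractf[symmetric] sum_divide_distrib right_diff_distrib diff_divide_distrib)
    also have "(\<Sum>j\<in>UNIV. A t $ i $ j * w (t + h) $ j) = rho (t + h) * w (t + h) $ i + h * y h $ i"
    proof -
      have "h * y h $ i = (\<Sum>j\<in>UNIV. A t $ i $ j * w (t + h) $ j - A (t + h) $ i $ j * w (t + h) $ j)"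
        unfolding y_def vec_lambda_beta sum_negf[symmetric] sum_distrib_left using that
        by (intro sum.cong refl) (simp add: field_simps)
      then show ?thesis by (simp add: sum_subtractf w_eigen)
    qed
    finally show "(bordered (A t) (rho t) x0 (w (t + h)) *v z h) $ i = y h $ i"
      using that by (simp add: field_simps)
  qed
  have wc: "((\<lambda>h. w (t + h) $ i) \<longlongrightarrow> w t $ i) (at 0)" for i
    using w_isCont[where k=i and t=t] by (simp add: isCont_iff)
  have lim: "((\<lambda>h. z h $ k) \<longlongrightarrow> dz t $ k) (at 0)" for k
  proof (rule linear_solution_tendsto[where y = y and C = "\<lambda>h. bordered (A t) (rho t) x0 (w (t + h))",
        OF _ _ _ dz])
    show "det (bordered (A t) (rho t) x0 (w t)) \<noteq> 0"
      by (simp add: rho_def det_bordered_nz[OF sc] w_pos)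
    show "\<forall>\<^sub>F h in at 0. bordered (A t) (rho t) x0 (w (t + h)) *v z h = y h"
      using eq by (auto simp: eventually_at intro!: exI[of _ 1])
    have "((\<lambda>h. - (\<Sum>j\<in>UNIV. (A (t + h) $ i $ j - A t $ i $ j) / h * w (t + h) $ j))
        \<longlongrightarrow> - (\<Sum>j\<in>UNIV. A' t $ i $ j * w t $ j)) (at 0)" for i
      by (intro tendsto_minus tendsto_sum tendsto_mult A[unfolded DERIV_def] wc)
    then show "((\<lambda>h. y h $ i) \<longlongrightarrow> (\<chi> i. - (\<Sum>j\<in>UNIV. A' t $ i $ j * w t $ j)) $ i) (at 0)" for i
      by (simp add: y_def)
  qed (auto simp: bordered_def intro!: wc)
  show "(rho has_real_derivative - dz t $ x0) (at t)"
  proof -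
    have "(\<lambda>h. (rho (t + h) - rho t) / h) = (\<lambda>h. - z h $ x0)"
      by (simp add: z_def fun_eq_iff minus_divide_left)
    then show ?thesis using tendsto_minus[OF lim[of x0]] by (simp only: DERIV_def)
  qed
  show "((\<lambda>s. w s $ k) has_real_derivative (if k = x0 then 0 else dz t $ k)) (at t)"
    using lim[of k] by (auto simp: DERIV_def z_def w_x0)
qed

text \<open>The coefficients of the system defining \<open>dz\<close> involve only \<open>A\<close>,
  \<open>A'\<close>, \<open>rho\<close> and \<open>w\<close>, which are now known to be
  differentiable; this yields the second derivatives.\<close>

lemma dz_DERIV: "\<exists>D. ((\<lambda>s. dz s $ k) has_real_derivative D) (at t)"
proof (rule linear_solution_DERIV[OF _ _ _ dz])
  show "((\<lambda>s. bordered (A s) (rho s) x0 (w s) $ i $ j) has_real_derivative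
      (\<chi> i j. if j = x0 then (if i = x0 then 0 else dz t $ i)
        else A' t $ i $ j - (if i = j then - dz t $ x0 else 0)) $ i $ j) (at t)" for i j
    unfolding bordered_def
    using rho_w_DERIV(2)[of i t] by (auto intro!: derivative_eq_intros rho_w_DERIV(1) A split: if_splits)
  show "((\<lambda>s. (\<chi> i. - (\<Sum>j\<in>UNIV. A' s $ i $ j * w s $ j)) $ i) has_real_derivative
      (\<chi> i. - (\<Sum>j\<in>UNIV. A'' t $ i $ j * w t $ j + (if j = x0 then 0 else dz t $ j) * A' t $ i $ j)) $ i) (at t)" for i
    by (auto intro!: derivative_eq_intros rho_w_DERIV A')
  show "det (bordered (A t) (rho t) x0 (w t)) \<noteq> 0"
    by (simp add: rho_def det_bordered_nz[OF sc] w_pos)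
qed

end


section \<open>The twisted chain\<close>

lemma strongly_connected_tilted:
  assumes "stochastic P" "irreducible_on UNIV P"
  shows "strongly_connected (tilted P f t)"
proof -
  have "0 < P $ x $ y * exp (t * f y) \<longleftrightarrow> 0 < P $ x $ y" for x y
    by (simp add: zero_less_mult_iff)
  then show ?thesis
    using irreducible_imp_strongly_connected[OF assms(2)]
    by (simp add: strongly_connected_def tilted_def)
qed

text \<open>Here \<open>h t\<close> is a logarithm of the right Perron eigenvector up to a constant
  depending on \<open>t\<close>. Only differences of its values matter, so a smooth normalisation
  may replace that of \<open>perron_pair\<close>.\<close>

locale tilted_chain =
  fixes P :: "real ^ 's ^ 's::finite" and f :: "'s \<Rightarrow> real"
    and h h1 h2 :: "real \<Rightarrow> 's \<Rightarrow> real" and L1 L2 :: "real \<Rightarrow> real"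
  assumes P: "stochastic P"
    and perron_ratio: "perron_right P f t x / perron_right P f t y = exp (h t x - h t y)"
    and h: "((\<lambda>s. h s x) has_real_derivative h1 t x) (at t)"
    and h1: "((\<lambda>s. h1 s x) has_real_derivative h2 t x) (at t)"
    and Lam: "(Lam P f has_real_derivative L1 t) (at t)"
    and L1: "(L1 has_real_derivative L2 t) (at t)"
    and eigen: "(\<Sum>y\<in>UNIV. P $ x $ y * exp (t * f y + h t y - h t x - Lam P f t)) = 1"
    and invariant: "\<exists>m. (\<forall>x. 0 \<le> m x) \<and> (\<Sum>x\<in>UNIV. m x) = 1 \<and>
      (\<forall>y. (\<Sum>x\<in>UNIV. m x * (P $ x $ y * exp (t * f y + h t y - h t x - Lam P f t))) = m y)"
    and h_0: "h 0 x = h 0 y"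

lemma ex_tilted_chain:
  fixes P :: "real ^ 's ^ 's::finite"
  assumes P: "stochastic P" "irreducible_on UNIV P"
  shows "\<exists>h h1 h2 L1 L2. tilted_chain P f h h1 h2 L1 L2"
proof -
  interpret perron_family "tilted P f" "\<lambda>t. \<chi> i j. P $ i $ j * exp (t * f j) * f j"
    "\<lambda>t. \<chi> i j. P $ i $ j * exp (t * f j) * f j * f j" "undefined :: 's"
    by unfold_locales
      ((rule strongly_connected_tilted[OF P]; fail) | auto simp: tilted_def intro!: derivative_eq_intros)+
  have rho_pos: "rho t > 0" for t
  proof -
    have "\<exists>j. P $ undefined $ j \<noteq> 0"
      using P(1) unfolding stochastic_def by (metis sum.neutral zero_neq_one)
    then obtain j where j: "P $ undefined $ j > 0"
      using P(1) unfolding stochastic_def by (metis less_eq_real_def)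
    have "0 < (\<Sum>j\<in>UNIV. tilted P f t $ undefined $ j * w t $ j)"
      using j by (intro sum_pos2[of _ j])
        (use P(1) in \<open>auto simp: tilted_def stochastic_def w_pos less_imp_le[OF w_pos]\<close>)
    also have "\<dots> = rho t" by (simp add: w_eigen w_x0)
    finally show ?thesis .
  qed
  have Lam_eq: "Lam P f = (\<lambda>t. ln (rho t))" by (simp add: Lam_def rho_def fun_eq_iff)
  define h where "h t x = ln (w t $ x)" for t x
  define h1 where "h1 t x = (if x = undefined then 0 else dz t $ x) / w t $ x" for t x
  define L1 where "L1 t = - dz t $ undefined / rho t" for t
  have exp_h: "exp (h t x) = w t $ x" for t x using w_pos by (simp add: h_def)
  have P_exp: "P $ x $ y * exp (t * f y + h t y - h t x - Lam P f t)
      = tilted P f t $ x $ y * w t $ y / (rho t * w t $ x)" for t x y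
    using rho_pos w_pos by (simp add: exp_add exp_diff exp_h Lam_eq tilted_def field_simps)
  have "tilted_chain P f h h1 (\<lambda>t x. deriv (\<lambda>s. h1 s x) t) L1 (deriv L1)"
  proof
    show "stochastic P" by fact
    fix t x y
    show "perron_right P f t x / perron_right P f t y = exp (h t x - h t y)"
      using uv(2)[of t undefined] by (simp add: exp_diff exp_h perron_right_def v_def[symmetric] w_def)
    show "((\<lambda>s. h s x) has_real_derivative h1 t x) (at t)"
      using DERIV_chain2[OF DERIV_ln[OF w_pos] rho_w_DERIV(2)[of x t]]
      unfolding h_def h1_def by (simp add: divide_inverse mult.commute)
    show "(Lam P f has_real_derivative L1 t) (at t)"
      using DERIV_chain2[OF DERIV_ln[OF rho_pos] rho_w_DERIV(1)[of t]]
      unfolding Lam_eq L1_def by (simp add: divide_inverse mult.commute)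
    obtain D where D: "((\<lambda>s. dz s $ x) has_real_derivative D) (at t)" using dz_DERIV by blast
    have "\<exists>D. ((\<lambda>s. h1 s x) has_real_derivative D) (at t)"
    proof (cases "x = undefined")
      case False
      then show ?thesis using DERIV_divide[OF D rho_w_DERIV(2)[of x t]] w_pos[of t x]
        by (auto simp: h1_def)
    qed (auto simp: h1_def intro!: exI[of _ 0])
    then show "((\<lambda>s. h1 s x) has_real_derivative deriv (\<lambda>s. h1 s x) t) (at t)"
      by (auto dest: DERIV_imp_deriv)
    obtain D where D: "((\<lambda>s. dz s $ undefined) has_real_derivative D) (at t)" using dz_DERIV by blast
    have "\<exists>D. (L1 has_real_derivative D) (at t)"
      using DERIV_divide[OF DERIV_minus[OF D] rho_w_DERIV(1)[of t]] rho_pos[of t]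
      unfolding L1_def by auto
    then show "(L1 has_real_derivative deriv L1 t) (at t)"
      by (auto dest: DERIV_imp_deriv)
    show "(\<Sum>y\<in>UNIV. P $ x $ y * exp (t * f y + h t y - h t x - Lam P f t)) = 1"
      unfolding P_exp sum_divide_distrib[symmetric] w_eigen
      using rho_pos[of t] w_pos[of t x] by simp
    define s where "s = (\<Sum>x\<in>UNIV. u t $ x * w t $ x)"
    have s: "s > 0" unfolding s_def by (intro sum_pos mult_pos_pos uv w_pos) auto
    \<comment> \<open>The stationary law of the twisted chain is the product of the left and right
      eigenvectors; \<open>s\<close> corrects for the scaling of \<open>w\<close>.\<close>
    define m where "m x = u t $ x * w t $ x / s" for x
    have "(\<Sum>x\<in>UNIV. m x * (P $ x $ y * exp (t * f y + h t y - h t x - Lam P f t))) = m y" for y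
    proof -
      have "m x * (P $ x $ y * exp (t * f y + h t y - h t x - Lam P f t))
          = (u t $ x * tilted P f t $ x $ y) * (w t $ y / (s * rho t))" for x
        unfolding P_exp m_def using w_pos[of t x] by (simp add: field_simps)
      then have "(\<Sum>x\<in>UNIV. m x * (P $ x $ y * exp (t * f y + h t y - h t x - Lam P f t)))
          = (\<Sum>x\<in>UNIV. u t $ x * tilted P f t $ x $ y) * (w t $ y / (s * rho t))"
        by (simp only: sum_distrib_right)
      then show ?thesis
        unfolding left_eigenvector_entry[OF uv(3)] m_def using rho_pos[of t] by simp
    qed
    moreover have "(\<Sum>x\<in>UNIV. m x) = 1"
      using s unfolding m_def sum_divide_distrib[symmetric] s_def[symmetric] by simp
    moreover have "0 \<le> m x" for x
      using s uv(1)[of t x] w_pos[of t x] by (simp add: m_def)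
    ultimately show "\<exists>m. (\<forall>x. 0 \<le> m x) \<and> (\<Sum>x\<in>UNIV. m x) = 1 \<and>
      (\<forall>y. (\<Sum>x\<in>UNIV. m x * (P $ x $ y * exp (t * f y + h t y - h t x - Lam P f t))) = m y)"
      by blast
    \<comment> \<open>Without tilting the matrix is \<open>P\<close>, whose Perron eigenvector is
      constant.\<close>
    have "tilted P f 0 *v 1 = 1 *s (1 :: real ^ 's)"
      using P(1) by (simp add: vec_eq_iff matrix_vector_mult_def tilted_def stochastic_def)
    moreover from this have "rho 0 = 1"
      unfolding rho_def by (rule spectral_radius_eq[OF sc]) simp
    ultimately obtain c where "(1 :: real ^ 's) = c *s v 0"
      using pos_eigenvector_unique[OF sc[of 0] uv(4)[of 0] uv(2)[of 0], of 1] by auto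
    then have "1 = c * v 0 $ x" "1 = c * v 0 $ y" by (simp_all add: vec_eq_iff)
    then have "v 0 $ x = v 0 $ y" by (metis mult_left_cancel mult_zero_left zero_neq_one)
    then show "h 0 x = h 0 y" by (simp add: h_def w_def)
  qed
  then show ?thesis by blast
qed

section \<open>Score identities and the derivatives of \<open>Lam\<close>\<close>

context tilted_chain
begin

lemma P_nonneg: "0 \<le> P $ x $ y" and P_sum: "(\<Sum>y\<in>UNIV. P $ x $ y) = 1"
  using P by (auto simp: stochastic_def)

definition p :: "real \<Rightarrow> 's \<Rightarrow> 's \<Rightarrow> real" where
  "p t x y = P $ x $ y * exp (t * f y + h t y - h t x - Lam P f t)"

definition score :: "real \<Rightarrow> 's \<Rightarrow> 's \<Rightarrow> real" where
  "score t x y = f y + h1 t y - h1 t x - L1 t"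

lemma p_nonneg: "0 \<le> p t x y"
  by (simp add: p_def P_nonneg)

lemma p_sum: "(\<Sum>y\<in>UNIV. p t x y) = 1"
  using eigen by (simp add: p_def)

lemma p_DERIV: "((\<lambda>s. p s x y) has_real_derivative p t x y * score t x y) (at t)"
  unfolding p_def score_def by (auto intro!: derivative_eq_intros h Lam)

lemma score_sum: "(\<Sum>y\<in>UNIV. p t x y * score t x y) = 0"
proof -
  have "((\<lambda>s. \<Sum>y\<in>UNIV. p s x y) has_real_derivative (\<Sum>y\<in>UNIV. p t x y * score t x y)) (at t)"
    by (intro DERIV_sum p_DERIV)
  moreover have "((\<lambda>s. \<Sum>y\<in>UNIV. p s x y) has_real_derivative 0) (at t)" by (simp add: p_sum)
  ultimately show ?thesis by (rule DERIV_unique)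
qed

lemma score_sq_sum:
  "(\<Sum>y\<in>UNIV. p t x y * (score t x y)\<^sup>2) = L2 t + h2 t x - (\<Sum>y\<in>UNIV. p t x y * h2 t y)"
proof -
  have "((\<lambda>s. \<Sum>y\<in>UNIV. p s x y * score s x y) has_real_derivative
      (\<Sum>y\<in>UNIV. p t x y * score t x y * score t x y + (h2 t y - h2 t x - L2 t) * p t x y)) (at t)"
    by (intro DERIV_sum DERIV_mult' p_DERIV) (auto simp: score_def intro!: derivative_eq_intros h1 L1 p_DERIV[unfolded score_def])
  moreover have "((\<lambda>s. \<Sum>y\<in>UNIV. p s x y * score s x y) has_real_derivative 0) (at t)"
    by (simp add: score_sum)
  ultimately have "(\<Sum>y\<in>UNIV. p t x y * score t x y * score t x y + (h2 t y - h2 t x - L2 t) * p t x y) = 0"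
    by (rule DERIV_unique)
  moreover have "(\<Sum>y\<in>UNIV. p t x y * score t x y * score t x y + (h2 t y - h2 t x - L2 t) * p t x y)
      = (\<Sum>y\<in>UNIV. p t x y * (score t x y)\<^sup>2) + (\<Sum>y\<in>UNIV. p t x y * h2 t y) - (h2 t x + L2 t) * (\<Sum>y\<in>UNIV. p t x y)"
    by (simp add: sum.distrib sum_subtractf sum_distrib_left algebra_simps power2_eq_square)
  ultimately show ?thesis by (simp add: p_sum)
qed

text \<open>The terms with \<open>h2\<close> in \<open>score_sq_sum\<close> cancel when averaged
  against an invariant distribution of \<open>p t\<close>.\<close>

lemma L2_variance:
  "\<exists>m. (\<forall>x. 0 \<le> m x) \<and> (\<Sum>x\<in>UNIV. m x) = 1 \<and>
     L2 t = (\<Sum>x\<in>UNIV. m x * (\<Sum>y\<in>UNIV. p t x y * (score t x y)\<^sup>2))"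
proof -
  obtain m where m: "\<And>x. 0 \<le> m x" "(\<Sum>x\<in>UNIV. m x) = 1" "\<And>y. (\<Sum>x\<in>UNIV. m x * p t x y) = m y"
    using invariant[of t] unfolding p_def by auto
  have "(\<Sum>x\<in>UNIV. m x * (\<Sum>y\<in>UNIV. p t x y * h2 t y)) = (\<Sum>y\<in>UNIV. (\<Sum>x\<in>UNIV. m x * p t x y) * h2 t y)"
    by (simp add: sum_distrib_left sum_distrib_right mult_ac) (rule sum.swap)
  also have "\<dots> = (\<Sum>x\<in>UNIV. m x * h2 t x)" by (simp only: m(3))
  finally have "(\<Sum>x\<in>UNIV. m x * (\<Sum>y\<in>UNIV. p t x y * (score t x y)\<^sup>2)) = L2 t * (\<Sum>x\<in>UNIV. m x)"
    unfolding score_sq_sum by (simp add: algebra_simps sum.distrib sum_subtractf sum_distrib_left)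
  then show ?thesis using m by (intro exI[of _ m]) simp
qed

lemma L2_nonneg: "0 \<le> L2 t"
  using L2_variance[of t] by (auto intro!: sum_nonneg mult_nonneg_nonneg p_nonneg)

text \<open>Popoviciu's inequality, row by row: a mean-zero variable with values between
  \<open>lo\<close> and \<open>hi\<close> has second moment at most \<open>- (hi * lo)\<close>,
  because the product of its distances to the endpoints is nonnegative.\<close>

lemma L2_le:
  assumes f: "\<And>x. a \<le> f x" "\<And>x. f x \<le> b" and D: "\<And>x y. \<bar>h1 t x - h1 t y\<bar> \<le> D"
  shows "L2 t \<le> (b - a + 2 * D)\<^sup>2 / 4"
proof -
  define lo hi where "lo = a - L1 t - D" and "hi = b - L1 t + D"
  have le: "(\<Sum>y\<in>UNIV. p t x y * (score t x y)\<^sup>2) \<le> (hi - lo)\<^sup>2 / 4" for x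
  proof -
    have "lo \<le> score t x y" "score t x y \<le> hi" for y
      using f[of y] D[of x y] by (auto simp: lo_def hi_def score_def abs_le_iff)
    then have "0 \<le> (\<Sum>y\<in>UNIV. p t x y * ((hi - score t x y) * (score t x y - lo)))"
      by (intro sum_nonneg mult_nonneg_nonneg p_nonneg) auto
    also have "\<dots> = (hi + lo) * (\<Sum>y\<in>UNIV. p t x y * score t x y) - (\<Sum>y\<in>UNIV. p t x y * (score t x y)\<^sup>2)
        - hi * lo * (\<Sum>y\<in>UNIV. p t x y)"
      by (simp add: algebra_simps sum.distrib sum_subtractf sum_distrib_left power2_eq_square)
    finally have "(\<Sum>y\<in>UNIV. p t x y * (score t x y)\<^sup>2) \<le> - (hi * lo)" by (simp add: score_sum p_sum)
    moreover have "0 \<le> (hi + lo)\<^sup>2" by simp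
    ultimately show ?thesis by (simp add: power2_eq_square algebra_simps)
  qed
  obtain m where m: "\<And>x. 0 \<le> m x" "(\<Sum>x\<in>UNIV. m x) = 1"
     "L2 t = (\<Sum>x\<in>UNIV. m x * (\<Sum>y\<in>UNIV. p t x y * (score t x y)\<^sup>2))"
    using L2_variance[of t] by auto
  have "L2 t \<le> (\<Sum>x\<in>UNIV. m x * ((hi - lo)\<^sup>2 / 4))"
    unfolding m(3) by (intro sum_mono mult_left_mono le m)
  also have "\<dots> = (hi - lo)\<^sup>2 / 4" by (simp only: sum_distrib_right[symmetric] m(2) mult_1)
  also have "hi - lo = b - a + 2 * D" by (simp add: hi_def lo_def)
  finally show ?thesis .
qed

lemma Lam_0: "Lam P f 0 = 0"
proof -
  have "P $ x $ y * exp (0 * f y + h 0 y - h 0 x - Lam P f 0) = exp (- Lam P f 0) * P $ x $ y" for x y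
    using h_0[of x y] by simp
  then have "1 = exp (- Lam P f 0)"
    using eigen[where t = 0 and x = undefined]
    by (simp only: sum_distrib_left[symmetric] P_sum)
  then show ?thesis by simp
qed

text \<open>At parameter 0 the twisted matrix is \<open>P\<close>; integrating
  \<open>score_sum\<close> against the stationary distribution cancels the terms with
  \<open>h1\<close>.\<close>

lemma L1_0:
  assumes "stationary P \<pi>"
  shows "L1 0 = expect \<pi> f"
proof -
  have p0: "p 0 x y = P $ x $ y" for x y
    using h_0[of x y] by (simp add: p_def Lam_0)
  have st: "(\<Sum>x\<in>UNIV. \<pi> $ x * P $ x $ y) = \<pi> $ y" for y
    using left_eigenvector_entry[of \<pi> P 1 y] assms by (simp add: stationary_def)
  have "(\<Sum>x\<in>UNIV. \<pi> $ x * (\<Sum>y\<in>UNIV. P $ x $ y * (f y + h1 0 y)))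
      = (\<Sum>y\<in>UNIV. (\<Sum>x\<in>UNIV. \<pi> $ x * P $ x $ y) * (f y + h1 0 y))"
    by (simp add: sum_distrib_left sum_distrib_right mult.assoc) (rule sum.swap)
  moreover have "(\<Sum>y\<in>UNIV. P $ x $ y * (f y + h1 0 y)) = h1 0 x + L1 0" for x
  proof -
    have "(\<Sum>y\<in>UNIV. P $ x $ y * (f y + h1 0 y)) - (h1 0 x + L1 0) * (\<Sum>y\<in>UNIV. P $ x $ y) = 0"
      using score_sum[of 0 x] unfolding p0 score_def
      by (simp add: algebra_simps sum.distrib sum_subtractf sum_distrib_left)
    then show ?thesis by (simp add: P_sum)
  qed
  ultimately have "(\<Sum>x\<in>UNIV. \<pi> $ x * (h1 0 x + L1 0)) = (\<Sum>y\<in>UNIV. \<pi> $ y * (f y + h1 0 y))"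
    by (simp add: st)
  moreover have "(\<Sum>x\<in>UNIV. \<pi> $ x) = 1" using assms by (simp add: stationary_def prob_vector_def)
  ultimately show ?thesis
    by (simp add: expect_def distrib_left sum.distrib sum_distrib_left[symmetric] mult.commute)
qed

lemma Lam_le:
  assumes "stationary P \<pi>" and s: "\<And>t. 0 \<le> t \<Longrightarrow> L2 t \<le> s" and t: "0 \<le> t"
  shows "Lam P f t \<le> t * expect \<pi> f + s * t\<^sup>2 / 2"
proof (cases "t = 0")
  case False
  \<comment> \<open>Second-order Taylor expansion at 0; the list supplies the successive
    derivatives.\<close>
  obtain c where c: "0 < c" "c < t"
    "Lam P f t = (\<Sum>m<2. ([Lam P f, L1, L2] ! m) 0 / fact m * t ^ m) + ([Lam P f, L1, L2] ! 2) c / fact 2 * t ^ 2"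
  proof (atomize_elim, rule Maclaurin)
    show "0 < t" using t False by simp
    show "\<forall>m x. m < 2 \<and> 0 \<le> x \<and> x \<le> t \<longrightarrow>
        (([Lam P f, L1, L2] ! m) has_real_derivative ([Lam P f, L1, L2] ! Suc m) x) (at x)"
      using Lam L1 by (auto simp: less_2_cases_iff)
  qed auto
  then have "Lam P f t = t * expect \<pi> f + L2 c * t\<^sup>2 / 2"
    by (simp add: numeral_2_eq_2 Lam_0 L1_0[OF assms(1)] mult.commute)
  then show ?thesis using s[of c] c by (simp add: mult_right_mono)
qed (simp add: Lam_0)

end


section \<open>Uniform bounds for nonnegative tilting parameters\<close>

text \<open>Only the head of each edge is required to lie in \<open>T\<close>, so that the same
  relation can also describe paths that start outside \<open>T\<close>.\<close>

lemma submatrix_power_pos_imp_path: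
  assumes A: "\<And>x y. 0 \<le> A $ x $ y" and "x \<in> T" "y \<in> T" "0 < submatrix_power T A n x y"
  shows "(x, y) \<in> {(x, y). y \<in> T \<and> 0 < A $ x $ y}\<^sup>*"
  using assms(2-)
proof (induction n arbitrary: x)
  case (Suc n)
  obtain z where z: "z \<in> T" "0 < A $ x $ z * submatrix_power T A n z y"
    using Suc.prems(3) sum_nonpos[of T "\<lambda>z. A $ x $ z * submatrix_power T A n z y"]
    by (auto simp: not_le[symmetric])
  then have "0 < A $ x $ z" "0 < submatrix_power T A n z y"
    using A[of x z] by (auto simp: zero_less_mult_iff)
  with Suc.IH[OF z(1) Suc.prems(2)] z(1) show ?case
    by (auto intro: converse_rtrancl_into_rtrancl)
qed (auto split: if_splits)

text \<open>Since the power witnessing irreducibility is at least 1, it has a first factor; this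
  excludes an isolated state.\<close>

lemma irreducible_on_successor:
  assumes "irreducible_on T A" "x \<in> T"
  shows "\<exists>y\<in>T. 0 < A $ x $ y"
proof -
  obtain n where n: "n \<ge> 1" "0 < submatrix_power T A n x x"
    using assms unfolding irreducible_on_def by blast
  then obtain m where "n = Suc m" by (cases n) auto
  then obtain z where z: "z \<in> T" "0 < A $ x $ z * submatrix_power T A m z x"
    using n sum_nonpos[of T "\<lambda>z. A $ x $ z * submatrix_power T A m z x"]
    by (auto simp: not_le[symmetric])
  moreover have "0 \<le> A $ x $ z" using assms z(1) by (auto simp: irreducible_on_def)
  ultimately show ?thesis using z by (auto simp: zero_less_mult_iff)
qed

text \<open>Iterating the edge inequality along a fixed path gives a constant that depends on the
  path but not on \<open>G\<close> or \<open>d\<close>. It serves with \<open>d = 0\<close> for the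
  eigenvector and with \<open>d = b - a\<close> for its logarithmic derivative.\<close>

lemma propagation_bound:
  fixes E :: "('s::finite \<times> 's) set" and c :: real
  assumes c: "0 \<le> c" and E: "\<And>x y. y \<in> S \<Longrightarrow> (x, y) \<in> E\<^sup>*"
  shows "\<exists>C\<ge>0. \<forall>G d x y. (\<forall>s. 0 \<le> G s) \<longrightarrow> 0 \<le> d \<longrightarrow> (\<forall>(s, t)\<in>E. G t \<le> c * (G s + d)) \<longrightarrow>
    y \<in> S \<longrightarrow> G y \<le> C * (G x + d)"
proof -
  have "\<exists>C\<ge>0. \<forall>G d. (\<forall>s. 0 \<le> G s) \<longrightarrow> 0 \<le> d \<longrightarrow> (\<forall>(s, t)\<in>E. G t \<le> c * (G s + d)) \<longrightarrow>
      G y \<le> C * (G x + d)" if "(x, y) \<in> E\<^sup>*" for x y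
    using that
  proof (induction rule: rtrancl_induct)
    case base
    show ?case by (intro exI[of _ 1]) auto
  next
    case (step y z)
    then obtain C where C: "C \<ge> 0" "\<And>G d. (\<forall>s. 0 \<le> G s) \<Longrightarrow> 0 \<le> d \<Longrightarrow>
        (\<forall>(s, t)\<in>E. G t \<le> c * (G s + d)) \<Longrightarrow> G y \<le> C * (G x + d)" by blast
    have "G z \<le> c * (C + 1) * (G x + d)"
      if G: "\<forall>s. 0 \<le> G s" "0 \<le> d" "\<forall>(s, t)\<in>E. G t \<le> c * (G s + d)" for G d
    proof -
      have "G z \<le> c * (G y + d)" using G(3) step(2) by auto
      also have "\<dots> \<le> c * (C * (G x + d) + (G x + d))"
        using C(2)[OF G] G(1,2) by (intro mult_left_mono c add_mono) auto
      finally show ?thesis by (simp add: algebra_simps)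
    qed
    then show ?case using c C(1) by (intro exI[of _ "c * (C + 1)"]) auto
  qed
  then have "\<forall>x y. \<exists>C. y \<in> S \<longrightarrow> C \<ge> 0 \<and> (\<forall>G d. (\<forall>s. 0 \<le> G s) \<longrightarrow> 0 \<le> d \<longrightarrow>
      (\<forall>(s, t)\<in>E. G t \<le> c * (G s + d)) \<longrightarrow> G y \<le> C * (G x + d))"
    using E by blast
  then obtain C where C: "\<And>x y. y \<in> S \<Longrightarrow> C x y \<ge> 0" "\<And>x y G d. y \<in> S \<Longrightarrow> (\<forall>s. 0 \<le> G s) \<Longrightarrow> 0 \<le> d \<Longrightarrow>
      (\<forall>(s, t)\<in>E. G t \<le> c * (G s + d)) \<Longrightarrow> G y \<le> C x y * (G x + d)"
    by metis
  \<comment> \<open>The sum over all pairs dominates each of the finitely many constants.\<close>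
  define B where "B = (\<Sum>x\<in>UNIV. \<Sum>y\<in>S. C x y)"
  have "C x y \<le> B" if "y \<in> S" for x y
  proof -
    have "C x y \<le> (\<Sum>y\<in>S. C x y)" by (rule member_le_sum) (use that C(1) in auto)
    also have "\<dots> \<le> B" unfolding B_def by (rule member_le_sum) (auto intro!: sum_nonneg C(1))
    finally show ?thesis .
  qed
  then have "G y \<le> B * (G x + d)" if "y \<in> S" "\<forall>s. 0 \<le> G s" "0 \<le> d"
      "\<forall>(s, t)\<in>E. G t \<le> c * (G s + d)" for G d x y
    using C(2)[OF that, of x] that by (meson add_nonneg_nonneg mult_right_mono order_trans)
  moreover have "B \<ge> 0" unfolding B_def by (intro sum_nonneg C(1))
  ultimately show ?thesis by blast
qed

lemma ex_maximizer: "\<exists>x. \<forall>y. g y \<le> (g x :: real)" for g :: "'s::finite \<Rightarrow> real"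
proof -
  have "Max (range g) \<in> range g" by (rule Max_in) auto
  moreover have "g y \<le> Max (range g)" for y by (rule Max_ge) auto
  ultimately show ?thesis by (metis imageE)
qed

lemma ex_minimizer: "\<exists>x. \<forall>y. (g x :: real) \<le> g y" for g :: "'s::finite \<Rightarrow> real"
  using ex_maximizer[of "\<lambda>x. - g x"] by simp

lemma ex_pos_lower_bound:
  fixes g :: "'s::finite \<Rightarrow> real"
  shows "\<exists>e>0. e \<le> 1 \<and> (\<forall>x. 0 < g x \<longrightarrow> e \<le> g x)"
proof -
  \<comment> \<open>Inserting 1 makes the set nonempty and gives the bound
    \<open>e \<le> 1\<close>.\<close>
  define e where "e = Min (insert 1 {g x | x. 0 < g x})"
  have fin: "finite (insert 1 {g x | x. 0 < g x})" by simp
  then have "e \<in> insert 1 {g x | x. 0 < g x}" unfolding e_def by (rule Min_in) simp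
  then have "0 < e" by auto
  moreover have "e \<le> y" if "y \<in> insert 1 {g x | x. 0 < g x}" for y
    unfolding e_def using fin that by (rule Min_le)
  ultimately show ?thesis by blast
qed

lemma SUP_ereal_finite:
  fixes F :: "'i \<Rightarrow> real"
  assumes I: "I \<noteq> {}" and B: "\<And>i. i \<in> I \<Longrightarrow> F i \<le> B"
  shows "\<exists>K. (SUP i\<in>I. ereal (F i)) = ereal K \<and> (\<forall>i\<in>I. F i \<le> K) \<and> K \<le> B"
proof (intro exI conjI ballI)
  have bdd: "bdd_above (F ` I)" using B by (rule bdd_aboveI2)
  show le: "F i \<le> (SUP i\<in>I. F i)" if "i \<in> I" for i using bdd that by (rule cSUP_upper[rotated])
  show "(SUP i\<in>I. F i) \<le> B" using I B by (rule cSUP_least)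
  show "(SUP i\<in>I. ereal (F i)) = ereal (SUP i\<in>I. F i)"
  proof (rule SUP_eqI)
    fix y assume y: "\<And>i. i \<in> I \<Longrightarrow> ereal (F i) \<le> y"
    then show "ereal (SUP i\<in>I. F i) \<le> y"
      using I by (cases y) (auto intro!: cSUP_least)
  qed (simp add: le)
qed

section \<open>Eigenvector ratios and their logarithmic derivatives\<close>

locale tilted_chain_max = tilted_chain +
  fixes a b :: real and S :: "'a set"
  assumes f_ge: "a \<le> f x" and f_le: "f x \<le> b" and S: "S = {x. f x = b}" and S_ne: "S \<noteq> {}"
    and irred: "irreducible_on S P"
    and into_S: "x \<notin> S \<Longrightarrow> \<exists>y\<in>S. P $ x $ y > 0"
begin

definition E where "E = {(x, y). y \<in> S \<and> 0 < P $ x $ y}"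

lemma ex_edge: "\<exists>y. (x, y) \<in> E"
  using irreducible_on_successor[OF irred] into_S by (cases "x \<in> S") (auto simp: E_def)

lemma edgeD: "(u, v) \<in> E \<Longrightarrow> f v = b" "(u, v) \<in> E \<Longrightarrow> 0 < P $ u $ v"
  unfolding E_def by (auto simp: S)

text \<open>A first edge leads from any state into \<open>S\<close>; irreducibility within
  \<open>S\<close> supplies the rest of the path.\<close>

lemma path_into_S:
  assumes "y \<in> S"
  shows "(x, y) \<in> E\<^sup>*"
proof -
  have in_S: "(z, y) \<in> E\<^sup>*" if "z \<in> S" for z
    using irred that assms submatrix_power_pos_imp_path[of P, OF P_nonneg, of z S y]
    unfolding irreducible_on_def E_def by blast
  show ?thesis
    using ex_edge[of x] in_S by (auto simp: E_def intro: converse_rtrancl_into_rtrancl)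
qed

text \<open>The logarithm of the spectral radius when the tilting uses \<open>f - b\<close> in place
  of \<open>f\<close>.\<close>

definition r :: "real \<Rightarrow> real" where "r t = Lam P f t - t * b"

lemma p_eq: "p t x y = P $ x $ y * exp (h t y - h t x - t * (b - f y) - r t)"
  by (simp add: p_def r_def algebra_simps)

lemma p_le_1: "p t x y \<le> 1"
  using member_le_sum[of y UNIV "p t x"] p_nonneg p_sum[of t x] by auto

text \<open>In the row of a maximiser of \<open>h t\<close>, the row sum 1 is at most
  \<open>exp (- r t)\<close>. In the row of a minimiser, an edge into \<open>S\<close> already has
  twisted weight at least \<open>e * exp (- r t)\<close>, and that weight is at most 1.\<close>

lemma exp_r_bounds:
  "\<exists>e>0. e \<le> 1 \<and> (\<forall>x y. 0 < P $ x $ y \<longrightarrow> e \<le> P $ x $ y) \<and> (\<forall>t\<ge>0. r t \<le> 0 \<and> e \<le> exp (r t))"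
proof -
  obtain e where e: "e > 0" "e \<le> 1" "\<And>x y. 0 < P $ x $ y \<Longrightarrow> e \<le> P $ x $ y"
    using ex_pos_lower_bound[of "\<lambda>(x, y). P $ x $ y"] by auto
  have "r t \<le> 0 \<and> e \<le> exp (r t)" if t: "t \<ge> 0" for t
  proof
    obtain x where x: "\<And>y. h t y \<le> h t x" using ex_maximizer[of "h t"] by auto
    have "p t x y \<le> P $ x $ y * exp (- r t)" for y
    proof -
      have "0 \<le> t * (b - f y)" using t f_le[of y] by simp
      then show ?thesis unfolding p_eq using x[of y] by (intro mult_left_mono P_nonneg) auto
    qed
    then have "(\<Sum>y\<in>UNIV. p t x y) \<le> (\<Sum>y\<in>UNIV. P $ x $ y * exp (- r t))" by (rule sum_mono)
    also have "\<dots> = exp (- r t)" by (simp only: sum_distrib_right[symmetric] P_sum mult_1)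
    finally show "r t \<le> 0" by (simp add: p_sum)
    obtain x where x: "\<And>y. h t x \<le> h t y" using ex_minimizer[of "h t"] by auto
    obtain y where y: "y \<in> S" "0 < P $ x $ y" using ex_edge[of x] by (auto simp: E_def)
    have "e * exp (- r t) \<le> p t x y"
      unfolding p_eq using x[of y] y e(1) by (intro mult_mono e(3)) (auto simp: S)
    also have "\<dots> \<le> 1" by (rule p_le_1)
    finally show "e \<le> exp (r t)" by (simp add: exp_minus field_simps)
  qed
  then show ?thesis using e by blast
qed

text \<open>Along an edge into \<open>S\<close> the tilting factor is 1 and
  \<open>r t \<le> 0\<close>, so a twisted probability at most 1 bounds the ratio by
  \<open>1 / e\<close>. The bound is then propagated along paths.\<close>

lemma ratio_into_S_bounded:
  "\<exists>C\<ge>0. \<forall>t\<ge>0. \<forall>x. \<forall>y\<in>S. exp (h t y - h t x) \<le> C"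
proof -
  obtain e where e: "e > 0" "\<And>x y. 0 < P $ x $ y \<Longrightarrow> e \<le> P $ x $ y" "\<And>t. t \<ge> 0 \<Longrightarrow> r t \<le> 0"
    using exp_r_bounds by auto
  obtain C where C: "C \<ge> 0" "\<And>G d x y. (\<forall>s. 0 \<le> G s) \<Longrightarrow> 0 \<le> d \<Longrightarrow>
      (\<forall>(s, t)\<in>E. G t \<le> 1 / e * (G s + d)) \<Longrightarrow> y \<in> S \<Longrightarrow> G y \<le> C * (G x + d)"
    using propagation_bound[of "1 / e" S E, OF _ path_into_S] e(1) by auto
  have "exp (h t y - h t x) \<le> C" if t: "t \<ge> 0" and y: "y \<in> S" for t x y
  proof -
    have "exp (h t v) \<le> 1 / e * (exp (h t u) + 0)" if "(u, v) \<in> E" for u v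
    proof -
      have "e * exp (h t v - h t u) \<le> p t u v"
        unfolding p_eq using edgeD[OF that] e(1) e(3)[OF t] by (intro mult_mono e(2)) auto
      also have "\<dots> \<le> 1" by (rule p_le_1)
      finally show ?thesis using e(1) by (simp add: exp_diff field_simps)
    qed
    then have "exp (h t y) \<le> C * (exp (h t x) + 0)"
      using y by (intro C(2)) auto
    then show ?thesis by (simp add: exp_diff field_simps)
  qed
  then show ?thesis using C(1) by blast
qed

text \<open>For large \<open>t\<close>, consider a maximiser \<open>m\<close> of \<open>h t\<close>.
  If it lies in \<open>S\<close>, the previous bound applies. Otherwise the transitions from
  \<open>m\<close> that avoid \<open>S\<close> are damped by \<open>exp (- (t * d))\<close>, so
  those into \<open>S\<close>, already controlled by \<open>C\<close>, must carry a fixed part of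
  the row sum. Small \<open>t\<close> are covered by compactness.\<close>

lemma ratio_bounded: "\<exists>K. \<forall>t\<ge>0. \<forall>x y. exp (h t x - h t y) \<le> K"
proof -
  obtain e where e: "e > 0" "e \<le> 1" "\<And>t. t \<ge> 0 \<Longrightarrow> e \<le> exp (r t)"
    using exp_r_bounds by auto
  obtain C where C: "C \<ge> 0" "\<And>t x y. t \<ge> 0 \<Longrightarrow> y \<in> S \<Longrightarrow> exp (h t y - h t x) \<le> C"
    using ratio_into_S_bounded by auto
  \<comment> \<open>A gap between \<open>b\<close> and the other values of \<open>f\<close>.\<close>
  obtain d where d: "d > 0" "\<And>y. y \<notin> S \<Longrightarrow> d \<le> b - f y"
    using ex_pos_lower_bound[of "\<lambda>y. b - f y"] f_le by (auto simp: S) (metis less_eq_real_def)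
  \<comment> \<open>From \<open>T\<close> on the damping factor is at most \<open>e / 2\<close>,
    half of the lower bound for \<open>exp (r t)\<close>.\<close>
  define T where "T = max 0 (ln (2 / e) / d)"
  have large: "exp (h t z - h t x) \<le> 2 * C / e" if t: "t \<ge> T" for t z x
  proof -
    have t0: "t \<ge> 0" using t by (simp add: T_def)
    obtain m where m: "\<And>y. h t y \<le> h t m" using ex_maximizer[of "h t"] by auto
    have "exp (h t m - h t x) \<le> 2 * C / e"
    proof (cases "m \<in> S")
      case True
      then have "exp (h t m - h t x) \<le> C" by (intro C t0)
      moreover have "C * e \<le> C * 2" using C(1) e by (intro mult_left_mono) auto
      then have "C \<le> 2 * C / e" using e by (simp add: field_simps)
      ultimately show ?thesis by simp
    next
      case False
      have "ln (2 / e) \<le> t * d" using t d(1) by (simp add: T_def field_simps)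
      then have "exp (- (t * d)) \<le> exp (- ln (2 / e))" by simp
      then have half: "exp (- (t * d)) \<le> e / 2" using e(1) by (simp add: exp_minus)
      have er: "exp (- r t) \<le> 1 / e" using e(1) e(3)[OF t0] by (simp add: exp_minus field_simps)
      have "p t m y \<le> P $ m $ y * ((C * exp (h t x - h t m) + e / 2) * (1 / e))" for y
      proof -
        have le: "exp (h t y - h t m - t * (b - f y)) \<le> C * exp (h t x - h t m) + e / 2"
        proof (cases "y \<in> S")
          case True
          have "exp (h t y - h t m) = exp (h t y - h t x) * exp (h t x - h t m)"
            by (simp add: exp_add[symmetric])
          also have "\<dots> \<le> C * exp (h t x - h t m)" using True by (intro mult_right_mono C t0) auto
          finally show ?thesis using True e(1) by (simp add: S)
        next
          case False
          have "t * d \<le> t * (b - f y)" using d(2)[OF False] t0 by (rule mult_left_mono)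
          then have "exp (h t y - h t m - t * (b - f y)) \<le> exp (- (t * d))" using m[of y] by simp
          also note half
          also have "e / 2 \<le> C * exp (h t x - h t m) + e / 2" using C(1) by simp
          finally show ?thesis .
        qed
        have eq: "p t m y = P $ m $ y * (exp (h t y - h t m - t * (b - f y)) * exp (- r t))"
          by (simp add: p_eq exp_add[symmetric])
        show ?thesis
          unfolding eq by (intro mult_left_mono mult_mono P_nonneg le er) (use C(1) e(1) in auto)
      qed
      then have "(\<Sum>y\<in>UNIV. p t m y) \<le> (\<Sum>y\<in>UNIV. P $ m $ y * ((C * exp (h t x - h t m) + e / 2) * (1 / e)))"
        by (rule sum_mono)
      also have "\<dots> = (C * exp (h t x - h t m) + e / 2) * (1 / e)"
        by (simp only: sum_distrib_right[symmetric] P_sum mult_1)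
      \<comment> \<open>The left side is the row sum 1; multiplied by \<open>e\<close>, it exceeds
        the damped part by at least \<open>e / 2\<close>.\<close>
      finally have "e / 2 \<le> C * exp (h t x - h t m)" using e(1) by (simp add: p_sum field_simps)
      moreover have "exp (h t x - h t m) = 1 / exp (h t m - h t x)" by (simp add: exp_diff)
      ultimately show ?thesis using e(1) by (simp add: field_simps)
    qed
    moreover have "exp (h t z - h t x) \<le> exp (h t m - h t x)" using m by simp
    ultimately show ?thesis by (rule order_trans[rotated])
  qed
  \<comment> \<open>Summing over all pairs gives one continuous function that dominates every
    ratio.\<close>
  have "continuous_on {0..T} (\<lambda>t. \<Sum>x\<in>UNIV. \<Sum>y\<in>UNIV. exp (h t x - h t y))"
    by (intro continuous_intros DERIV_continuous_on[OF has_field_derivative_at_within[OF h]])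
  then have "\<exists>s\<in>{0..T}. \<forall>t\<in>{0..T}.
      (\<Sum>x\<in>UNIV. \<Sum>y\<in>UNIV. exp (h t x - h t y)) \<le> (\<Sum>x\<in>UNIV. \<Sum>y\<in>UNIV. exp (h s x - h s y))"
    by (intro continuous_attains_sup) (auto simp: T_def)
  then obtain s where s: "\<And>t. t \<in> {0..T} \<Longrightarrow>
      (\<Sum>x\<in>UNIV. \<Sum>y\<in>UNIV. exp (h t x - h t y)) \<le> (\<Sum>x\<in>UNIV. \<Sum>y\<in>UNIV. exp (h s x - h s y))"
    by blast
  have "exp (h t x - h t y) \<le> max (2 * C / e) (\<Sum>x\<in>UNIV. \<Sum>y\<in>UNIV. exp (h s x - h s y))" if "t \<ge> 0" for t x y
  proof (cases "t \<ge> T")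
    case False
    have "exp (h t x - h t y) \<le> (\<Sum>y\<in>UNIV. exp (h t x - h t y))"
      by (rule member_le_sum) auto
    also have "\<dots> \<le> (\<Sum>x\<in>UNIV. \<Sum>y\<in>UNIV. exp (h t x - h t y))"
      by (rule member_le_sum) (auto intro!: sum_nonneg)
    also note s[of t]
    finally show ?thesis using False that by simp
  qed (use large in \<open>simp add: max.coboundedI1\<close>)
  then show ?thesis by blast
qed

text \<open>In the row of an extremum of \<open>h1 t\<close>, the differences of \<open>h1 t\<close>
  have one sign, so the mean-zero identity compares \<open>L1 t\<close> with \<open>b\<close> or
  \<open>a\<close>.\<close>

lemma L1_bounds: "a \<le> L1 t" "L1 t \<le> b"
proof -
  have e: "L1 t = (\<Sum>y\<in>UNIV. p t x y * (f y + h1 t y - h1 t x))" for x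
  proof -
    have "(\<Sum>y\<in>UNIV. p t x y * (f y + h1 t y - h1 t x)) - L1 t * (\<Sum>y\<in>UNIV. p t x y) = 0"
      using score_sum[of t x] unfolding score_def
      by (simp add: algebra_simps sum.distrib sum_subtractf sum_distrib_left)
    then show ?thesis by (simp add: p_sum)
  qed
  obtain x where x: "\<And>y. h1 t y \<le> h1 t x" using ex_maximizer[of "h1 t"] by auto
  have "L1 t \<le> (\<Sum>y\<in>UNIV. p t x y * b)" unfolding e[of x]
  proof (intro sum_mono mult_left_mono p_nonneg)
    fix y show "f y + h1 t y - h1 t x \<le> b" using f_le[of y] x[of y] by linarith
  qed
  then show "L1 t \<le> b" by (simp add: sum_distrib_right[symmetric] p_sum)
  obtain x where x: "\<And>y. h1 t x \<le> h1 t y" using ex_minimizer[of "h1 t"] by auto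
  have "(\<Sum>y\<in>UNIV. p t x y * a) \<le> L1 t" unfolding e[of x]
  proof (intro sum_mono mult_left_mono p_nonneg)
    fix y show "a \<le> f y + h1 t y - h1 t x" using f_ge[of y] x[of y] by linarith
  qed
  then show "a \<le> L1 t" by (simp add: sum_distrib_right[symmetric] p_sum)
qed

text \<open>The derivative of the logarithm of the right eigenvector solves a Poisson equation for the
  twisted chain, so its deviation from an extremum grows in a controlled way along edges into \<open>S\<close>,
  whose twisted probabilities are bounded below uniformly in the tilting parameter.\<close>

lemma h1_osc_bounded: "\<exists>D. \<forall>t\<ge>0. \<forall>x y. \<bar>h1 t x - h1 t y\<bar> \<le> D"
proof -
  obtain e where e: "e > 0" "\<And>x y. 0 < P $ x $ y \<Longrightarrow> e \<le> P $ x $ y" "\<And>t. t \<ge> 0 \<Longrightarrow> r t \<le> 0"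
    using exp_r_bounds by auto
  obtain K where K: "\<And>t x y. t \<ge> 0 \<Longrightarrow> exp (h t x - h t y) \<le> K" using ratio_bounded by auto
  have "K \<ge> 1" using K[of 0 undefined undefined] by simp
  obtain C where C: "C \<ge> 0" "\<And>G d x y. (\<forall>s. 0 \<le> G s) \<Longrightarrow> 0 \<le> d \<Longrightarrow>
      (\<forall>(s, t)\<in>E. G t \<le> K / e * (G s + d)) \<Longrightarrow> y \<in> S \<Longrightarrow> G y \<le> C * (G x + d)"
    using propagation_bound[of "K / e" S E, OF _ path_into_S] e(1) \<open>K \<ge> 1\<close> by auto
  have ab: "a \<le> b" using f_ge[of undefined] f_le[of undefined] by linarith
  obtain z where z: "z \<in> S" using S_ne by auto
  \<comment> \<open>To be applied with \<open>G\<close> the distance of \<open>h1 t\<close> from its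
    maximum or from its minimum; \<open>x\<close> is a state where the extremum is attained.\<close>
  have spread: "G z \<le> C * (b - a)" if t: "t \<ge> 0" and G: "\<And>x. 0 \<le> G x" "G x = 0"
      "\<And>x. (\<Sum>y\<in>UNIV. p t x y * G y) \<le> G x + (b - a)" for t G x
  proof -
    have "G v \<le> K / e * (G u + (b - a))" if uv: "(u, v) \<in> E" for u v
    proof -
      have "exp (h t u - h t v) \<le> K" by (rule K[OF t])
      \<comment> \<open>The ratio bound in the reverse direction, together with
        \<open>r t \<le> 0\<close>, keeps the twisted probability of an edge above
        \<open>e / K\<close>.\<close>
      then have "1 / K \<le> exp (h t v - h t u)" using \<open>K \<ge> 1\<close> by (simp add: exp_diff field_simps)
      also have "\<dots> \<le> exp (h t v - h t u - t * (b - f v) - r t)"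
        using edgeD[OF uv] e(3)[OF t] by simp
      finally have "e * (1 / K) \<le> p t u v"
        unfolding p_eq using edgeD[OF uv] \<open>K \<ge> 1\<close> e(1) by (intro mult_mono e(2)) auto
      then have "e * (1 / K) * G v \<le> p t u v * G v" by (intro mult_right_mono G)
      also have "\<dots> \<le> (\<Sum>y\<in>UNIV. p t u y * G y)"
        by (rule member_le_sum) (auto intro!: mult_nonneg_nonneg p_nonneg G)
      also have "\<dots> \<le> G u + (b - a)" by (rule G)
      finally show ?thesis using e(1) \<open>K \<ge> 1\<close> by (simp add: field_simps)
    qed
    then have "G z \<le> C * (G x + (b - a))" using ab z G(1) by (intro C(2)) auto
    then show ?thesis by (simp add: G)
  qed
  have mean: "a \<le> (\<Sum>y\<in>UNIV. p t x y * f y)" "(\<Sum>y\<in>UNIV. p t x y * f y) \<le> b" for t x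
  proof -
    have "(\<Sum>y\<in>UNIV. p t x y * a) \<le> (\<Sum>y\<in>UNIV. p t x y * f y)"
      by (intro sum_mono mult_left_mono p_nonneg f_ge)
    then show "a \<le> (\<Sum>y\<in>UNIV. p t x y * f y)" by (simp add: sum_distrib_right[symmetric] p_sum)
    have "(\<Sum>y\<in>UNIV. p t x y * f y) \<le> (\<Sum>y\<in>UNIV. p t x y * b)"
      by (intro sum_mono mult_left_mono p_nonneg f_le)
    then show "(\<Sum>y\<in>UNIV. p t x y * f y) \<le> b" by (simp add: sum_distrib_right[symmetric] p_sum)
  qed
  have poisson: "(\<Sum>y\<in>UNIV. p t x y * h1 t y) = h1 t x + L1 t - (\<Sum>y\<in>UNIV. p t x y * f y)" for t x
  proof -
    have "(\<Sum>y\<in>UNIV. p t x y * h1 t y) + (\<Sum>y\<in>UNIV. p t x y * f y) - (L1 t + h1 t x) * (\<Sum>y\<in>UNIV. p t x y) = 0"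
      using score_sum[of t x] unfolding score_def
      by (simp add: algebra_simps sum.distrib sum_subtractf sum_distrib_left)
    then show ?thesis by (simp add: p_sum)
  qed
  have "\<bar>h1 t x - h1 t y\<bar> \<le> 2 * (C * (b - a))" if t: "t \<ge> 0" for t x y
  proof -
    \<comment> \<open>Paths are available only into \<open>S\<close>, so the maximum and the minimum
      are each compared with the value at the fixed state \<open>z\<close> of \<open>S\<close>; this
      gives the factor 2.\<close>
    obtain u where u: "\<And>y. h1 t y \<le> h1 t u" using ex_maximizer[of "h1 t"] by auto
    obtain l where l: "\<And>y. h1 t l \<le> h1 t y" using ex_minimizer[of "h1 t"] by auto
    have "h1 t u - h1 t z \<le> C * (b - a)"
    proof (rule spread[OF t, where G = "\<lambda>x. h1 t u - h1 t x" and x = u])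
      fix x
      have "(\<Sum>y\<in>UNIV. p t x y * (h1 t u - h1 t y)) = h1 t u * (\<Sum>y\<in>UNIV. p t x y) - (\<Sum>y\<in>UNIV. p t x y * h1 t y)"
        by (simp add: right_diff_distrib sum_subtractf sum_distrib_left mult.commute[of "h1 t _"])
      then show "(\<Sum>y\<in>UNIV. p t x y * (h1 t u - h1 t y)) \<le> h1 t u - h1 t x + (b - a)"
        using mean[of t x] L1_bounds[of t] by (simp add: p_sum poisson)
    qed (use u in auto)
    moreover have "h1 t z - h1 t l \<le> C * (b - a)"
    proof (rule spread[OF t, where G = "\<lambda>x. h1 t x - h1 t l" and x = l])
      fix x
      have "(\<Sum>y\<in>UNIV. p t x y * (h1 t y - h1 t l)) = (\<Sum>y\<in>UNIV. p t x y * h1 t y) - h1 t l * (\<Sum>y\<in>UNIV. p t x y)"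
        by (simp add: right_diff_distrib sum_subtractf sum_distrib_left mult.commute[of "h1 t _"])
      then show "(\<Sum>y\<in>UNIV. p t x y * (h1 t y - h1 t l)) \<le> h1 t x - h1 t l + (b - a)"
        using mean[of t x] L1_bounds[of t] by (simp add: p_sum poisson)
    qed (use l in auto)
    ultimately show ?thesis using u[of x] u[of y] l[of x] l[of y] by linarith
  qed
  then show ?thesis by blast
qed


text \<open>The crude bounds \<open>K0\<close> and \<open>D0\<close> make the suprema finite. The
  suprema themselves then bound the oscillation of \<open>h1 t\<close>, and \<open>L2_le\<close>
  gives the constant of the theorem.\<close>

lemma ex_constants:
  "\<exists>K L s. K_u P f = ereal K \<and> L_u P f = ereal L \<and> sigma_u_sq P f = ereal s \<and> 1 \<le> K \<and>
     (\<forall>t\<ge>0. \<forall>x y. exp (h t x - h t y) \<le> K) \<and> (\<forall>t\<ge>0. L2 t \<le> s) \<and> 0 \<le> s \<and>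
     s \<le> (b - a + 2 * (K * L))\<^sup>2 / 4"
proof -
  obtain K0 where K0: "\<And>t x y. t \<ge> 0 \<Longrightarrow> exp (h t x - h t y) \<le> K0" using ratio_bounded by auto
  obtain D0 where D0: "\<And>t x y. t \<ge> 0 \<Longrightarrow> \<bar>h1 t x - h1 t y\<bar> \<le> D0" using h1_osc_bounded by auto
  have K0_pos: "K0 \<ge> 0" using order_trans[OF exp_ge_zero K0[of 0]] by simp
  let ?I = "{0::real..} \<times> (UNIV :: 'a set) \<times> (UNIV :: 'a set)"
  obtain K where K: "(SUP i\<in>?I. ereal (case i of (t, x, y) \<Rightarrow> exp (h t x - h t y))) = ereal K"
    "\<And>i. i \<in> ?I \<Longrightarrow> (case i of (t, x, y) \<Rightarrow> exp (h t x - h t y)) \<le> K"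
    using SUP_ereal_finite[of ?I "\<lambda>(t, x, y). exp (h t x - h t y)" K0] K0 by auto
  have K': "exp (h t x - h t y) \<le> K" if "t \<ge> 0" for t x y
    using K(2)[of "(t, x, y)"] that by simp
  have "1 \<le> K" using K'[of 0 undefined undefined] by simp
  have Ku: "K_u P f = ereal K"
    unfolding K_u_def K(1)[symmetric] perron_ratio by (intro SUP_cong refl) auto
  have ratio_deriv: "deriv (\<lambda>t. perron_right P f t x / perron_right P f t y) t
      = exp (h t x - h t y) * (h1 t x - h1 t y)" for t x y
    unfolding perron_ratio by (rule DERIV_imp_deriv) (auto intro!: derivative_eq_intros h)
  have "\<bar>exp (h t x - h t y) * (h1 t x - h1 t y)\<bar> \<le> K0 * D0" if "t \<ge> 0" for t x y
    unfolding abs_mult using K0[OF that] D0[OF that] K0_pos by (intro mult_mono) auto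
  then obtain L where L:
    "(SUP i\<in>?I. ereal (case i of (t, x, y) \<Rightarrow> \<bar>exp (h t x - h t y) * (h1 t x - h1 t y)\<bar>)) = ereal L"
    "\<And>i. i \<in> ?I \<Longrightarrow> (case i of (t, x, y) \<Rightarrow> \<bar>exp (h t x - h t y) * (h1 t x - h1 t y)\<bar>) \<le> L"
    using SUP_ereal_finite[of ?I "\<lambda>(t, x, y). \<bar>exp (h t x - h t y) * (h1 t x - h1 t y)\<bar>" "K0 * D0"] by auto
  have L': "\<bar>exp (h t x - h t y) * (h1 t x - h1 t y)\<bar> \<le> L" if "t \<ge> 0" for t x y
    using L(2)[of "(t, x, y)"] that by simp
  have Lu: "L_u P f = ereal L"
    unfolding L_u_def L(1)[symmetric] ratio_deriv by (intro SUP_cong refl) auto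
  have "0 \<le> L" using L'[of 0 undefined undefined] by simp
  \<comment> \<open>The derivative of a ratio is the ratio times a difference of
    \<open>h1 t\<close>; dividing the ratio out costs a factor \<open>K\<close>, hence the product
    \<open>K * L\<close>.\<close>
  have osc: "\<bar>h1 t x - h1 t y\<bar> \<le> K * L" if t: "t \<ge> 0" for t x y
  proof -
    have "\<bar>h1 t x - h1 t y\<bar> = exp (h t y - h t x) * \<bar>exp (h t x - h t y) * (h1 t x - h1 t y)\<bar>"
      by (simp add: abs_mult exp_add[symmetric] mult.assoc[symmetric])
    also have "\<dots> \<le> K * L" using \<open>1 \<le> K\<close> by (intro mult_mono K'[OF t] L'[OF t]) auto
    finally show ?thesis .
  qed
  have L2: "L2 t \<le> (b - a + 2 * (K * L))\<^sup>2 / 4" if "t \<ge> 0" for t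
    by (rule L2_le[OF f_ge f_le osc[OF that]])
  then obtain s where s: "(SUP t\<in>{0..}. ereal (L2 t)) = ereal s" "\<And>t. t \<in> {0..} \<Longrightarrow> L2 t \<le> s"
      "s \<le> (b - a + 2 * (K * L))\<^sup>2 / 4"
    using SUP_ereal_finite[of "{0..}" L2 "(b - a + 2 * (K * L))\<^sup>2 / 4"] by auto
  have "deriv (Lam P f) = L1" using DERIV_imp_deriv[OF Lam] by (simp add: fun_eq_iff)
  then have sig: "sigma_u_sq P f = ereal s"
    using DERIV_imp_deriv[OF L1] by (simp add: sigma_u_sq_def s(1))
  have "0 \<le> s" using L2_nonneg[of 0] s(2)[of 0] by simp
  with Ku Lu sig \<open>1 \<le> K\<close> K' s show ?thesis
    by (intro exI[of _ K] exI[of _ L] exI[of _ s]) auto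
qed

end

section \<open>The Chernoff bound\<close>

lemma sum_PiE_atMost_Suc:
  fixes F :: "(nat \<Rightarrow> 's::finite) \<Rightarrow> real"
  shows "(\<Sum>x\<in>PiE {..Suc n} (\<lambda>_. UNIV). F x) = (\<Sum>x\<in>PiE {..n} (\<lambda>_. UNIV). \<Sum>y\<in>UNIV. F (x(Suc n := y)))"
proof -
  have "(\<Sum>x\<in>PiE {..Suc n} (\<lambda>_. UNIV). F x)
      = (\<Sum>z\<in>UNIV \<times> PiE {..n} (\<lambda>_. UNIV). F (case z of (y, x) \<Rightarrow> x(Suc n := y)))"
    unfolding atMost_Suc PiE_insert_eq
    by (subst sum.reindex[OF inj_combinator]) (auto intro!: sum.cong)
  also have "\<dots> = (\<Sum>y\<in>UNIV. \<Sum>x\<in>PiE {..n} (\<lambda>_. UNIV). F (x(Suc n := y)))"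
    by (simp add: sum.cartesian_product case_prod_unfold)
  finally show ?thesis by (subst (asm) sum.swap)
qed

locale finite_markov_chain =
  fixes M :: "'w measure" and X :: "nat \<Rightarrow> 'w \<Rightarrow> 's::finite" and q P
  assumes mc: "markov_chain M X q P"
begin

sublocale prob_space M
  using mc by (simp add: markov_chain_def)

lemma X_measurable [measurable]: "X k \<in> measurable M (count_space UNIV)"
  using mc by (simp add: markov_chain_def)

definition path_prob :: "nat \<Rightarrow> (nat \<Rightarrow> 's) \<Rightarrow> real" where
  "path_prob n x = prob {\<omega> \<in> space M. \<forall>k\<le>n. X k \<omega> = x k}"

text \<open>The Markov property covers paths of positive probability; a null path has only null
  extensions, so both sides vanish.\<close>

lemma path_prob_Suc: "path_prob (Suc n) (x(Suc n := y)) = path_prob n x * P $ x n $ y"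
proof (cases "path_prob n x > 0")
  case True
  have "{\<omega> \<in> space M. \<forall>k\<le>Suc n. X k \<omega> = (x(Suc n := y)) k}
      = {\<omega> \<in> space M. X (Suc n) \<omega> = y \<and> (\<forall>k\<le>n. X k \<omega> = x k)}"
    by (auto simp: le_Suc_eq)
  moreover have "\<P>(\<omega> in M. X (Suc n) \<omega> = y \<bar> \<forall>k\<le>n. X k \<omega> = x k) = P $ x n $ y"
    using mc True by (simp add: markov_chain_def path_prob_def)
  ultimately show ?thesis
    using True by (simp add: cond_prob_def path_prob_def field_simps)
next
  case False
  have "path_prob (Suc n) (x(Suc n := y)) \<le> path_prob n x"
    unfolding path_prob_def by (rule finite_measure_mono) (auto split: if_splits)
  moreover have "0 \<le> path_prob (Suc n) (x(Suc n := y))" by (simp add: path_prob_def)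
  ultimately have "path_prob n x = 0" "path_prob (Suc n) (x(Suc n := y)) = 0" using False by auto
  then show ?thesis by simp
qed

lemma prob_eq_sum_paths:
  assumes Q: "\<And>x y. (\<And>k. k \<le> n \<Longrightarrow> x k = y k) \<Longrightarrow> Q x \<longleftrightarrow> Q y"
  shows "prob {\<omega> \<in> space M. Q (\<lambda>k. X k \<omega>)} = (\<Sum>x\<in>{x \<in> PiE {..n} (\<lambda>_. UNIV). Q x}. path_prob n x)"
proof -
  let ?I = "{x \<in> PiE {..n} (\<lambda>_. UNIV). Q x}"
  let ?A = "\<lambda>x. {\<omega> \<in> space M. \<forall>k\<le>n. X k \<omega> = x k}"
  have "{\<omega> \<in> space M. Q (\<lambda>k. X k \<omega>)} = (\<Union>x\<in>?I. ?A x)"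
  proof safe
    fix \<omega> assume \<omega>: "\<omega> \<in> space M" "Q (\<lambda>k. X k \<omega>)"
    \<comment> \<open>Elements of the index set are \<open>undefined\<close> beyond
      \<open>n\<close>, so the trajectory is represented by its restriction, on which
      \<open>Q\<close> takes the same value.\<close>
    then have "restrict (\<lambda>k. X k \<omega>) {..n} \<in> ?I"
      using Q[of "restrict (\<lambda>k. X k \<omega>) {..n}" "\<lambda>k. X k \<omega>"] by auto
    moreover have "\<omega> \<in> ?A (restrict (\<lambda>k. X k \<omega>) {..n})" using \<omega> by auto
    ultimately show "\<omega> \<in> (\<Union>x\<in>?I. ?A x)" by blast
  next
    fix \<omega> x assume "Q x" "\<forall>k\<le>n. X k \<omega> = x k"
    then show "Q (\<lambda>k. X k \<omega>)" using Q[of x "\<lambda>k. X k \<omega>"] by auto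
  qed
  moreover have "prob (\<Union>x\<in>?I. ?A x) = (\<Sum>x\<in>?I. prob (?A x))"
  proof (rule finite_measure_finite_Union)
    show "finite ?I" by (rule finite_subset[OF _ finite_PiE[of "{..n}" "\<lambda>_. UNIV"]]) auto
    show "?A ` ?I \<subseteq> events" by auto
    show "disjoint_family_on ?A ?I"
    proof (unfold disjoint_family_on_def, intro ballI impI)
      fix x y assume "x \<in> ?I" "y \<in> ?I" "x \<noteq> y"
      then obtain k where "k \<le> n" "x k \<noteq> y k" by (auto simp: PiE_eq_iff[of _ _ _] dest: PiE_ext)
      then show "?A x \<inter> ?A y = {}" by auto
    qed
  qed
  ultimately show ?thesis by (simp add: path_prob_def)
qed

text \<open>An exponential martingale: by \<open>eigen\<close>, the expectation \<open>W m\<close>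
  does not depend on \<open>m\<close>. Replacing \<open>h\<close> by its extreme values at the two
  ends costs the factor \<open>K\<close>.\<close>

lemma chernoff_bound:
  fixes f h :: "'s \<Rightarrow> real"
  assumes eigen: "\<And>x. (\<Sum>y\<in>UNIV. P $ x $ y * exp (t * f y + h y - h x - l)) = 1"
    and K: "\<And>x y. exp (h x - h y) \<le> K" and t: "0 \<le> t" and n: "1 \<le> n"
  shows "\<P>(\<omega> in M. 1 / real n * (\<Sum>k=1..n. f (X k \<omega>)) \<ge> \<mu>) \<le> K * exp (real n * (l - t * \<mu>))"
proof -
  \<comment> \<open>The sum starts at 1, so the initial state enters through \<open>h\<close> alone
    and \<open>W 0\<close> is at most the exponential of the maximum of \<open>h\<close>, whatever
    the initial distribution.\<close>
  define W where "W m = (\<Sum>x\<in>PiE {..m} (\<lambda>_. UNIV). path_prob m x * exp ((\<Sum>k=1..m. t * f (x k) - l) + h (x m)))" for m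
  have W_Suc: "W (Suc m) = W m" for m
  proof -
    have "path_prob (Suc m) (x(Suc m := y)) *
        exp ((\<Sum>k=1..Suc m. t * f ((x(Suc m := y)) k) - l) + h ((x(Suc m := y)) (Suc m)))
      = path_prob m x * exp ((\<Sum>k=1..m. t * f (x k) - l) + h (x m)) *
        (P $ x m $ y * exp (t * f y + h y - h (x m) - l))" for x y
    proof -
      have "(\<Sum>k=1..Suc m. t * f ((x(Suc m := y)) k) - l) = (\<Sum>k=1..m. t * f (x k) - l) + (t * f y - l)"
      proof -
        have "(\<Sum>k=1..m. t * f ((x(Suc m := y)) k) - l) = (\<Sum>k=1..m. t * f (x k) - l)"
          by (intro sum.cong) auto
        then show ?thesis by (simp del: fun_upd_apply) simp
      qed
      then show ?thesis
        unfolding path_prob_Suc by (simp add: mult_ac exp_add[symmetric])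
    qed
    then show ?thesis
      unfolding W_def sum_PiE_atMost_Suc by (simp only: sum_distrib_left[symmetric] eigen mult_1_right)
  qed
  obtain u where u: "\<And>y. h y \<le> h u" using ex_maximizer[of h] by auto
  obtain v where v: "\<And>y. h v \<le> h y" using ex_minimizer[of h] by auto
  have "W n = W 0" by (induction n) (simp_all add: W_Suc)
  also have "\<dots> \<le> (\<Sum>x\<in>PiE {..0} (\<lambda>_. UNIV). path_prob 0 x * exp (h u))"
    unfolding W_def by (intro sum_mono mult_left_mono) (auto simp: path_prob_def u)
  also have "\<dots> = (\<Sum>x\<in>{x \<in> PiE {..0} (\<lambda>_. UNIV). True}. path_prob 0 x) * exp (h u)"
    by (simp add: sum_distrib_right)
  also have "\<dots> = exp (h u)"
    using prob_eq_sum_paths[of 0 "\<lambda>_. True"] by (simp add: prob_space)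
  finally have W_le: "W n \<le> exp (h u)" .
  \<comment> \<open>The constant for Markov's inequality: on the event in question, the exponential
    weight times \<open>c\<close> is at least 1.\<close>
  define c where "c = exp (real n * (l - t * \<mu>) - h v)"
  define Q where "Q x \<longleftrightarrow> \<mu> \<le> 1 / real n * (\<Sum>k=1..n. f (x k))" for x
  have "\<P>(\<omega> in M. 1 / real n * (\<Sum>k=1..n. f (X k \<omega>)) \<ge> \<mu>)
      = (\<Sum>x\<in>{x \<in> PiE {..n} (\<lambda>_. UNIV). Q x}. path_prob n x)"
    using prob_eq_sum_paths[of n Q] by (simp add: Q_def)
  also have "\<dots> \<le> (\<Sum>x\<in>{x \<in> PiE {..n} (\<lambda>_. UNIV). Q x}.
      path_prob n x * exp ((\<Sum>k=1..n. t * f (x k) - l) + h (x n)) * c)"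
  proof (rule sum_mono)
    fix x assume "x \<in> {x \<in> PiE {..n} (\<lambda>_. UNIV). Q x}"
    then have "real n * \<mu> \<le> (\<Sum>k=1..n. f (x k))" using n by (simp add: Q_def field_simps)
    then have "t * (real n * \<mu>) \<le> t * (\<Sum>k=1..n. f (x k))" using t by (rule mult_left_mono)
    moreover have "(\<Sum>k=1..n. t * f (x k) - l) = t * (\<Sum>k=1..n. f (x k)) - real n * l"
      by (simp add: sum_subtractf sum_distrib_left)
    ultimately have "0 \<le> (\<Sum>k=1..n. t * f (x k) - l) + h (x n) + (real n * (l - t * \<mu>) - h v)"
      using v[of "x n"] by (simp add: algebra_simps)
    then have "1 \<le> exp ((\<Sum>k=1..n. t * f (x k) - l) + h (x n)) * c"
      unfolding c_def exp_add[symmetric] by simp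
    then have "path_prob n x * 1 \<le> path_prob n x * (exp ((\<Sum>k=1..n. t * f (x k) - l) + h (x n)) * c)"
      by (rule mult_left_mono) (simp add: path_prob_def)
    then show "path_prob n x \<le> path_prob n x * exp ((\<Sum>k=1..n. t * f (x k) - l) + h (x n)) * c"
      by (simp add: mult.assoc)
  qed
  also have "\<dots> \<le> (\<Sum>x\<in>PiE {..n} (\<lambda>_. UNIV).
      path_prob n x * exp ((\<Sum>k=1..n. t * f (x k) - l) + h (x n)) * c)"
    by (rule sum_mono2) (auto simp: path_prob_def c_def intro: finite_PiE)
  also have "\<dots> = W n * c" by (simp add: W_def sum_distrib_right)
  also have "\<dots> \<le> exp (h u) * c" using W_le by (rule mult_right_mono) (simp add: c_def)
  also have "\<dots> = exp (h u - h v) * exp (real n * (l - t * \<mu>))"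
    by (simp add: c_def exp_add[symmetric])
  also have "\<dots> \<le> K * exp (real n * (l - t * \<mu>))" by (intro mult_right_mono K) simp
  finally show ?thesis .
qed

end

section \<open>Degenerate exponents and assembly of the theorem\<close>

lemma exp_ereal_gauss:
  assumes "n \<ge> 1" "0 \<le> D" "0 \<le> c"
  shows "exp_ereal (- (ereal (real n) * (ereal D / ereal c)))
    = ereal (if c = 0 then (if D = 0 then 1 else 0) else exp (- (real n * (D / c))))"
proof (cases "c = 0")
  case True
  then show ?thesis using assms
    by (auto simp: exp_ereal_def zero_ereal_def[symmetric] divide_ereal_def)
qed (simp add: exp_ereal_def)

theorem theorem2:
  fixes P :: "real ^ 's ^ 's" and \<pi> :: "real ^ 's" and f :: "'s::finite \<Rightarrow> real"
    and a b :: real and S\<^sub>b :: "'s set"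
  assumes "stochastic P"
    and "irreducible_on UNIV P"
    and "stationary P \<pi>"
    and "a = Min (range f)"
    and "b = Max (range f)"
    and "S\<^sub>b = {x. f x = b}"
    and "irreducible_on S\<^sub>b P"
    and "\<And>x. x \<notin> S\<^sub>b \<Longrightarrow> \<exists>y\<in>S\<^sub>b. P $ x $ y > 0"
  shows "sigma_u_sq P f < \<infinity> \<and> K_u P f < \<infinity> \<and> L_u P f < \<infinity> \<and>
    (\<forall>(M :: 'w measure) X q. \<forall>n::nat. \<forall>\<mu>::real.
       prob_vector q \<and> markov_chain M X q P \<and> n \<ge> 1 \<and> \<mu> \<ge> expect \<pi> f \<longrightarrow>
         ereal (\<P>(\<omega> in M. 1 / real n * (\<Sum>k=1..n. f (X k \<omega>)) \<ge> \<mu>))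
           \<le> K_u P f * exp_ereal (- (ereal (real n) *
               (ereal ((\<mu> - expect \<pi> f)\<^sup>2) / (2 * sigma_u_sq P f)))) \<and>
         K_u P f * exp_ereal (- (ereal (real n) *
               (ereal ((\<mu> - expect \<pi> f)\<^sup>2) / (2 * sigma_u_sq P f))))
           \<le> K_u P f * exp_ereal (- (ereal (real n) *
               (ereal (2 * (\<mu> - expect \<pi> f)\<^sup>2) /
                 (ereal (b - a) + 2 * K_u P f * L_u P f)\<^sup>2))))"
proof -
  obtain h h1 h2 L1 L2 where "tilted_chain P f h h1 h2 L1 L2"
    using ex_tilted_chain[OF assms(1,2)] by blast
  then interpret tilted_chain P f h h1 h2 L1 L2 .
  interpret tilted_chain_max P f h h1 h2 L1 L2 a b "S\<^sub>b"
  proof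
    show "a \<le> f x" "f x \<le> b" for x using assms(4,5) by auto
    have "b \<in> range f" unfolding assms(5) by (rule Max_in) auto
    then show "S\<^sub>b \<noteq> {}" using assms(6) by auto
  qed (fact assms)+
  obtain K L s where Ku: "K_u P f = ereal K" and Lu: "L_u P f = ereal L"
    and su: "sigma_u_sq P f = ereal s" and K: "1 \<le> K" "\<And>t x y. t \<ge> 0 \<Longrightarrow> exp (h t x - h t y) \<le> K"
    and s: "\<And>t. t \<ge> 0 \<Longrightarrow> L2 t \<le> s" "0 \<le> s" "s \<le> (b - a + 2 * (K * L))\<^sup>2 / 4"
    using ex_constants by auto
  define B where "B = (b - a + 2 * (K * L))\<^sup>2"
  have B: "B \<ge> 0" "4 * s \<le> B" using s(3) by (simp_all add: B_def)
  have "ereal (\<P>(\<omega> in M. 1 / real n * (\<Sum>k=1..n. f (X k \<omega>)) \<ge> \<mu>))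
           \<le> K_u P f * exp_ereal (- (ereal (real n) *
               (ereal ((\<mu> - expect \<pi> f)\<^sup>2) / (2 * sigma_u_sq P f)))) \<and>
         K_u P f * exp_ereal (- (ereal (real n) *
               (ereal ((\<mu> - expect \<pi> f)\<^sup>2) / (2 * sigma_u_sq P f))))
           \<le> K_u P f * exp_ereal (- (ereal (real n) *
               (ereal (2 * (\<mu> - expect \<pi> f)\<^sup>2) /
                 (ereal (b - a) + 2 * K_u P f * L_u P f)\<^sup>2)))"
    if mc: "markov_chain M X q P" and n: "n \<ge> 1" and mu: "\<mu> \<ge> expect \<pi> f"
    for M :: "'w measure" and X q and n :: nat and \<mu> :: real
  proof -
    interpret finite_markov_chain M X q P by (unfold_locales) (rule mc)
    define d where "d = \<mu> - expect \<pi> f"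
    have d: "d \<ge> 0" using mu by (simp add: d_def)
    define pr where "pr = \<P>(\<omega> in M. 1 / real n * (\<Sum>k=1..n. f (X k \<omega>)) \<ge> \<mu>)"
    define R1 where "R1 = (if 2 * s = 0 then (if d\<^sup>2 = 0 then 1 else 0) else exp (- (real n * (d\<^sup>2 / (2 * s)))))"
    define R2 where "R2 = (if B = 0 then (if 2 * d\<^sup>2 = 0 then 1 else 0) else exp (- (real n * (2 * d\<^sup>2 / B))))"
    have e1: "exp_ereal (- (ereal (real n) * (ereal (d\<^sup>2) / (2 * sigma_u_sq P f)))) = ereal R1"
    proof -
      have eq: "2 * sigma_u_sq P f = ereal (2 * s)" unfolding su by simp
      show ?thesis unfolding eq R1_def by (rule exp_ereal_gauss) (use n s(2) in auto)
    qed
    have e2: "exp_ereal (- (ereal (real n) * (ereal (2 * d\<^sup>2) / (ereal (b - a) + 2 * K_u P f * L_u P f)\<^sup>2))) = ereal R2"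
    proof -
      have eq: "(ereal (b - a) + 2 * K_u P f * L_u P f)\<^sup>2 = ereal B"
        unfolding Ku Lu B_def by (simp add: mult.assoc)
      show ?thesis unfolding eq R2_def by (rule exp_ereal_gauss) (use n B(1) in auto)
    qed
    have chern: "pr \<le> K * exp (real n * (s * t\<^sup>2 / 2 - t * d))" if t: "t \<ge> 0" for t
    proof -
      have "pr \<le> K * exp (real n * (Lam P f t - t * \<mu>))"
        unfolding pr_def by (rule chernoff_bound[OF eigen K(2)[OF t] t n])
      also have "\<dots> \<le> K * exp (real n * (s * t\<^sup>2 / 2 - t * d))"
      proof -
        have "Lam P f t - t * \<mu> \<le> s * t\<^sup>2 / 2 - t * d"
          using Lam_le[OF assms(3) s(1) t] by (simp add: d_def algebra_simps)
        then have "real n * (Lam P f t - t * \<mu>) \<le> real n * (s * t\<^sup>2 / 2 - t * d)"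
          by (rule mult_left_mono) simp
        then show ?thesis using K(1) by (intro mult_left_mono) auto
      qed
      finally show ?thesis .
    qed
    have pr1: "pr \<le> 1" "0 \<le> pr" by (simp_all add: pr_def)
    have "pr \<le> K * R1"
    proof (cases "s = 0")
      case True
      show ?thesis
      proof (cases "d = 0")
        case False
        have "pr \<le> 0"
        proof (rule ccontr)
          assume "\<not> pr \<le> 0"
          then have p: "pr > 0" by simp
          \<comment> \<open>For \<open>s = 0\<close> the Chernoff bound tends to 0 as
            \<open>t\<close> grows; this value brings it down to \<open>pr / 2\<close>, which a
            positive \<open>pr\<close> cannot satisfy.\<close>
          define t where "t = ln (2 * K / pr) / (real n * d)"
          have "1 \<le> 2 * K / pr" using p pr1 K(1) by simp
          then have "t \<ge> 0" using d by (simp add: t_def)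
          have "real n * (t * d) = ln (2 * K / pr)" using False n by (simp add: t_def)
          then have "pr \<le> K * exp (- ln (2 * K / pr))" using chern[OF \<open>t \<ge> 0\<close>] True by simp
          also have "\<dots> = pr / 2" using p K(1) by (simp add: exp_minus)
          finally show False using p by simp
        qed
        then show ?thesis using False True by (simp add: R1_def)
      qed (use True pr1 K(1) in \<open>simp add: R1_def\<close>)
    next
      case False
      \<comment> \<open>The parameter \<open>d / s\<close> minimises the quadratic exponent.\<close>
      have "s * (d / s)\<^sup>2 / 2 - d / s * d = - (d\<^sup>2 / (2 * s))"
        using False by (simp add: field_simps power2_eq_square)
      then show ?thesis using chern[of "d / s"] d s(2) False by (simp add: R1_def)
    qed
    \<comment> \<open>For positive \<open>s\<close> this is \<open>4 * s \<le> B\<close>. For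
      \<open>s = 0\<close>, either \<open>d\<close> is positive and \<open>R1\<close> is 0, or
      \<open>d\<close> is 0 and both values are 1.\<close>
    moreover have "R1 \<le> R2"
    proof (cases "s = 0")
      case False
      then have "s > 0" "B > 0" using s(2) B by auto
      have "4 * s * d\<^sup>2 \<le> B * d\<^sup>2" using B(2) by (rule mult_right_mono) simp
      then have "2 * d\<^sup>2 / B \<le> d\<^sup>2 / (2 * s)" using \<open>s > 0\<close> \<open>B > 0\<close> by (simp add: field_simps)
      then have "real n * (2 * d\<^sup>2 / B) \<le> real n * (d\<^sup>2 / (2 * s))" by (rule mult_left_mono) simp
      then show ?thesis using \<open>s > 0\<close> \<open>B > 0\<close> unfolding R1_def R2_def by simp
    qed (simp add: R1_def R2_def)
    then have "K * R1 \<le> K * R2" using K(1) by (intro mult_left_mono) auto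
    ultimately show ?thesis
      unfolding d_def[symmetric] e1 e2 pr_def[symmetric] unfolding Ku by simp
  qed
  moreover have "sigma_u_sq P f < \<infinity>" "K_u P f < \<infinity>" "L_u P f < \<infinity>" by (simp_all add: Ku Lu su)
  ultimately show ?thesis by blast
qed

end
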